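(* Let $\mathcal{C}$ be a triangulated category, $q>0$ a real number, and $\mathbf{S}$ a non-empty set of non-zero objects of $\mathcal{C}$. Suppose $\mathbf{S}$ contains objects $p_1,\dots,p_n$ such that $p=\bigoplus_i p_i$ is a (classical) generator of $\mathcal{C}$. Then the closure of the image of $m_q\colon \mathrm{Stab}(\mathcal{C})/\mathbf{C}\to\mathbf{P}^{\mathbf{S}}$ in $\mathbf{P}^{\mathbf{S}}$ is compact.
   Context: An object $p$ is a (classical) generator if every object $y$ of $\mathcal{C}$ is a direct summand of some object $x$ admitting a filtration $0\to x_0\to\cdots\to x_m=x$ whose factors (the cones of the successive maps) are shifts of $p$. $\mathrm{Stab}(\mathcal{C})$ is the space of locally finite Bridgeland stability conditions $\tau=(\mathcal{P},Z)$ on $\mathcal{C}$. The group $\mathbf{C}$ acts on it: for $\omega=a+i\pi b$, $(\omega\cdot\mathcal{P})(\phi)=\mathcal{P}(\phi-b)$ and $\omega\cdot Z=e^{\omega}Z$. For an object $x$ with Harder--Narasimhan factors $a_i$ semistable of phase $\phi_i$, the mass is $m_{q,\tau}(x)=\sum_i q^{\phi_i}|Z(a_i)|$. Let $\mathbf{R}^{\mathbf{S}}$ be the space of functions $\mathbf{S}\to\mathbf{R}$ with the product topology, and $\mathbf{P}^{\mathbf{S}}=(\mathbf{R}^{\mathbf{S}}\setminus\{0\})/\mathbf{R}^{\times}$ with the quotient topology. The $\mathbf{C}$-action only rescales the function $m_{q,\tau}\colon\mathbf{S}\to\mathbf{R}$, so $\tau\mapsto[m_{q,\tau}]$ gives a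 well-defined map $m_q\colon\mathrm{Stab}(\mathcal{C})/\mathbf{C}\to\mathbf{P}^{\mathbf{S}}$. *)

theory Defs
  imports "HOL-Analysis.Analysis" "HOL-Algebra.Free_Abelian_Groups"
begin

text \<open>
  Hom sets are not required to be pairwise disjoint, so a morphism does not determine its source
  and target; this is why the objects are passed along explicitly everywhere.
  \<open>dist x y z f g h\<close> says that
  \<open>x \<rightarrow> y \<rightarrow> z \<rightarrow> x[1]\<close>, with maps \<open>f\<close>, \<open>g\<close>, \<open>h\<close>, is a distinguished (exact) triangle.
\<close>

record ('o, 'm) tricat =
  Ob :: "'o set"
  Hom :: "'o \<Rightarrow> 'o \<Rightarrow> 'm set"
  cmp :: "'m \<Rightarrow> 'm \<Rightarrow> 'm" (infixr \<open>\<diamondop>\<index>\<close> 75)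
  idm :: "'o \<Rightarrow> 'm"
  addm :: "'m \<Rightarrow> 'm \<Rightarrow> 'm"
  zerom :: "'o \<Rightarrow> 'o \<Rightarrow> 'm"
  shO :: "'o \<Rightarrow> 'o"
  shM :: "'m \<Rightarrow> 'm"
  dist :: "'o \<Rightarrow> 'o \<Rightarrow> 'o \<Rightarrow> 'm \<Rightarrow> 'm \<Rightarrow> 'm \<Rightarrow> bool"

hide_const (open) dist

definition hom_group :: "('o, 'm) tricat \<Rightarrow> 'o \<Rightarrow> 'o \<Rightarrow> 'm monoid" where
  "hom_group C x y = \<lparr>carrier = Hom C x y, monoid.mult = addm C, one = zerom C x y\<rparr>"

definition zero_object :: "('o, 'm) tricat \<Rightarrow> 'o \<Rightarrow> bool" where
  "zero_object C x \<longleftrightarrow>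
     x \<in> Ob C \<and> (\<forall>y\<in>Ob C. (\<exists>!f. f \<in> Hom C x y) \<and> (\<exists>!f. f \<in> Hom C y x))"

definition is_iso :: "('o, 'm) tricat \<Rightarrow> 'o \<Rightarrow> 'o \<Rightarrow> 'm \<Rightarrow> bool" where
  "is_iso C x y f \<longleftrightarrow> x \<in> Ob C \<and> y \<in> Ob C \<and> f \<in> Hom C x y \<and>
     (\<exists>g\<in>Hom C y x. g \<diamondop>\<^bsub>C\<^esub> f = idm C x \<and> f \<diamondop>\<^bsub>C\<^esub> g = idm C y)"

definition isomorphic :: "('o, 'm) tricat \<Rightarrow> 'o \<Rightarrow> 'o \<Rightarrow> bool" where
  "isomorphic C x y \<longleftrightarrow> (\<exists>f. is_iso C x y f)"

text \<open>\<open>s\<close> is a biproduct of the finite family \<open>(x i)\<^sub>i\<^sub>\<in>\<^sub>I\<close>;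
  the \<open>finprod\<close> below is the sum of endomorphisms of \<open>s\<close>.\<close>

definition is_direct_sum :: "('o, 'm) tricat \<Rightarrow> 'i set \<Rightarrow> ('i \<Rightarrow> 'o) \<Rightarrow> 'o \<Rightarrow> bool" where
  "is_direct_sum C I x s \<longleftrightarrow> finite I \<and> s \<in> Ob C \<and> (\<forall>i\<in>I. x i \<in> Ob C) \<and>
     (\<exists>inj pr.
        (\<forall>i\<in>I. inj i \<in> Hom C (x i) s \<and> pr i \<in> Hom C s (x i)) \<and>
        (\<forall>i\<in>I. \<forall>j\<in>I. pr j \<diamondop>\<^bsub>C\<^esub> inj i = (if i = j then idm C (x i) else zerom C (x i) (x j))) \<and>
        finprod (hom_group C s s) (\<lambda>i. inj i \<diamondop>\<^bsub>C\<^esub> pr i) I = idm C s)"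

definition is_binary_sum :: "('o, 'm) tricat \<Rightarrow> 'o \<Rightarrow> 'o \<Rightarrow> 'o \<Rightarrow> bool" where
  "is_binary_sum C x y s \<longleftrightarrow> is_direct_sum C (UNIV :: bool set) (case_bool x y) s"

definition direct_summand :: "('o, 'm) tricat \<Rightarrow> 'o \<Rightarrow> 'o \<Rightarrow> bool" where
  "direct_summand C y x \<longleftrightarrow> (\<exists>y'. is_binary_sum C y y' x)"

locale additive_category =
  fixes C :: "('o, 'm) tricat" (structure)
  assumes hom_ob: "f \<in> Hom C x y \<Longrightarrow> x \<in> Ob C \<and> y \<in> Ob C"
    and cmp_closed: "f \<in> Hom C x y \<Longrightarrow> g \<in> Hom C y z \<Longrightarrow> g \<diamondop> f \<in> Hom C x z"
    and id_closed: "x \<in> Ob C \<Longrightarrow> idm C x \<in> Hom C x x"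
    and cmp_assoc: "f \<in> Hom C w x \<Longrightarrow> g \<in> Hom C x y \<Longrightarrow> h \<in> Hom C y z \<Longrightarrow>
                      (h \<diamondop> g) \<diamondop> f = h \<diamondop> (g \<diamondop> f)"
    and cmp_id_left: "f \<in> Hom C x y \<Longrightarrow> idm C y \<diamondop> f = f"
    and cmp_id_right: "f \<in> Hom C x y \<Longrightarrow> f \<diamondop> idm C x = f"
    and hom_comm_group: "x \<in> Ob C \<Longrightarrow> y \<in> Ob C \<Longrightarrow> comm_group (hom_group C x y)"
    and cmp_add_left: "f \<in> Hom C x y \<Longrightarrow> g \<in> Hom C y z \<Longrightarrow> g' \<in> Hom C y z \<Longrightarrow>
                      addm C g g' \<diamondop> f = addm C (g \<diamondop> f) (g' \<diamondop> f)"
    and cmp_add_right: "f \<in> Hom C x y \<Longrightarrow> f' \<in> Hom C x y \<Longrightarrow> g \<in> Hom C y z \<Longrightarrow>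
                      g \<diamondop> addm C f f' = addm C (g \<diamondop> f) (g \<diamondop> f')"
    and ex_zero_object: "\<exists>z. zero_object C z"
    and ex_binary_sum: "x \<in> Ob C \<Longrightarrow> y \<in> Ob C \<Longrightarrow> \<exists>s. is_binary_sum C x y s"

text \<open>The shift is an additive autoequivalence; it need not be bijective on objects.\<close>

locale triangulated_category = additive_category +
  assumes sh_ob: "x \<in> Ob C \<Longrightarrow> shO C x \<in> Ob C"
    and sh_id: "x \<in> Ob C \<Longrightarrow> shM C (idm C x) = idm C (shO C x)"
    and sh_cmp: "f \<in> Hom C x y \<Longrightarrow> g \<in> Hom C y z \<Longrightarrow> shM C (g \<diamondop> f) = shM C g \<diamondop> shM C f"
    and sh_add: "f \<in> Hom C x y \<Longrightarrow> g \<in> Hom C x y \<Longrightarrow>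
                   shM C (addm C f g) = addm C (shM C f) (shM C g)"
    and sh_fully_faithful: "x \<in> Ob C \<Longrightarrow> y \<in> Ob C \<Longrightarrow>
                   bij_betw (shM C) (Hom C x y) (Hom C (shO C x) (shO C y))"
    and sh_ess_surj: "y \<in> Ob C \<Longrightarrow> \<exists>x\<in>Ob C. isomorphic C (shO C x) y"
    and dist_typed: "tricat.dist C x y z f g h \<Longrightarrow>
                   f \<in> Hom C x y \<and> g \<in> Hom C y z \<and> h \<in> Hom C z (shO C x)"
    and TR1_iso: "\<lbrakk>tricat.dist C x y z f g h;
                   f' \<in> Hom C x' y'; g' \<in> Hom C y' z'; h' \<in> Hom C z' (shO C x');
                   is_iso C x x' a; is_iso C y y' b; is_iso C z z' c;
                   b \<diamondop> f = f' \<diamondop> a; c \<diamondop> g = g' \<diamondop> b; shM C a \<diamondop> h = h' \<diamondop> c\<rbrakk>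
                   \<Longrightarrow> tricat.dist C x' y' z' f' g' h'"
    and TR1_id: "x \<in> Ob C \<Longrightarrow> zero_object C z \<Longrightarrow>
                   tricat.dist C x x z (idm C x) (zerom C x z) (zerom C z (shO C x))"
    and TR1_cone: "f \<in> Hom C x y \<Longrightarrow> \<exists>z g h. tricat.dist C x y z f g h"
    and TR2: "\<lbrakk>f \<in> Hom C x y; g \<in> Hom C y z; h \<in> Hom C z (shO C x)\<rbrakk> \<Longrightarrow>
                   tricat.dist C x y z f g h \<longleftrightarrow>
                   tricat.dist C y z (shO C x) g h
                     (inv\<^bsub>hom_group C (shO C x) (shO C y)\<^esub> shM C f)"
    and TR3: "\<lbrakk>tricat.dist C x y z f g h; tricat.dist C x' y' z' f' g' h';
                   a \<in> Hom C x x'; b \<in> Hom C y y'; b \<diamondop> f = f' \<diamondop> a\<rbrakk> \<Longrightarrow>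
                   \<exists>c\<in>Hom C z z'. c \<diamondop> g = g' \<diamondop> b \<and> shM C a \<diamondop> h = h' \<diamondop> c"
    and TR4: "\<lbrakk>f \<in> Hom C x y; g \<in> Hom C y z;
                   tricat.dist C x y z' f a a';
                   tricat.dist C y z x' g b b';
                   tricat.dist C x z y' (g \<diamondop> f) c c'\<rbrakk> \<Longrightarrow>
                   \<exists>k l. tricat.dist C z' y' x' k l (shM C a \<diamondop> b') \<and>
                         k \<diamondop> a = c \<diamondop> g \<and> c' \<diamondop> k = a' \<and>
                         l \<diamondop> c = b \<and> b' \<diamondop> l = shM C f \<diamondop> c'"

definition ex_triangle :: "('o, 'm) tricat \<Rightarrow> 'o \<Rightarrow> 'o \<Rightarrow> 'o \<Rightarrow> bool" where
  "ex_triangle C x y z \<longleftrightarrow> (\<exists>f g h. tricat.dist C x y z f g h)"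

text \<open>\<open>0 = x 0 \<rightarrow> x 1 \<rightarrow> \<dots> \<rightarrow> x n\<close>, the cone of \<open>x i \<rightarrow> x (i + 1)\<close> being \<open>a i\<close>.\<close>

definition filtration :: "('o, 'm) tricat \<Rightarrow> nat \<Rightarrow> (nat \<Rightarrow> 'o) \<Rightarrow> (nat \<Rightarrow> 'o) \<Rightarrow> bool" where
  "filtration C n x a \<longleftrightarrow> zero_object C (x 0) \<and> (\<forall>i<n. ex_triangle C (x i) (x (Suc i)) (a i))"

text \<open>\<open>x\<close> is isomorphic to \<open>p[k]\<close> (first disjunct) or to \<open>p[-k]\<close> (second disjunct).\<close>

definition is_shift_of :: "('o, 'm) tricat \<Rightarrow> 'o \<Rightarrow> 'o \<Rightarrow> bool" where
  "is_shift_of C p x \<longleftrightarrow> x \<in> Ob C \<and>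
     (\<exists>k::nat. isomorphic C x ((shO C ^^ k) p) \<or> isomorphic C ((shO C ^^ k) x) p)"

text \<open>The terms \<open>x\<^sub>0, \<dots>, x\<^sub>m\<close> of the usual \<open>0 \<rightarrow> x\<^sub>0 \<rightarrow> \<dots> \<rightarrow> x\<^sub>m\<close> are
  \<open>x 1, \<dots>, x (Suc m)\<close> here.\<close>

definition classical_generator :: "('o, 'm) tricat \<Rightarrow> 'o \<Rightarrow> bool" where
  "classical_generator C p \<longleftrightarrow> p \<in> Ob C \<and>
     (\<forall>y\<in>Ob C. \<exists>m x a. filtration C (Suc m) x a \<and> (\<forall>i\<le>m. is_shift_of C p (a i)) \<and>
        direct_summand C y (x (Suc m)))"

definition K0_relations :: "('o, 'm) tricat \<Rightarrow> ('o \<Rightarrow>\<^sub>0 int) set" where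
  "K0_relations C = generate (free_Abelian_group (Ob C))
     {frag_of y - frag_of x - frag_of z | x y z. ex_triangle C x y z}"

definition K0 :: "('o, 'm) tricat \<Rightarrow> ('o \<Rightarrow>\<^sub>0 int) set monoid" where
  "K0 C = free_Abelian_group (Ob C) Mod K0_relations C"

definition K0_class :: "('o, 'm) tricat \<Rightarrow> 'o \<Rightarrow> ('o \<Rightarrow>\<^sub>0 int) set" where
  "K0_class C x = K0_relations C #>\<^bsub>free_Abelian_group (Ob C)\<^esub> frag_of x"

definition complex_group :: "complex monoid" where
  "complex_group = \<lparr>carrier = UNIV, monoid.mult = (+), one = 0\<rparr>"

type_synonym 'o slicing = "real \<Rightarrow> 'o set"
type_synonym 'o stability = "'o slicing \<times> (('o \<Rightarrow>\<^sub>0 int) set \<Rightarrow> complex)"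

definition HN_filtration ::
  "('o, 'm) tricat \<Rightarrow> 'o slicing \<Rightarrow> 'o \<Rightarrow> nat \<Rightarrow> (nat \<Rightarrow> 'o) \<Rightarrow> (nat \<Rightarrow> 'o) \<Rightarrow> (nat \<Rightarrow> real) \<Rightarrow> bool"
  where
  "HN_filtration C P y n x a \<phi> \<longleftrightarrow> filtration C n x a \<and> x n = y \<and>
     (\<forall>i<n. a i \<in> P (\<phi> i) \<and> \<not> zero_object C (a i)) \<and>
     (\<forall>i j. i < j \<and> j < n \<longrightarrow> \<phi> j < \<phi> i)"

text \<open>Full subcategories are given by their sets of objects, and those of a slicing are closed
  under isomorphism.  Accordingly the condition \<open>P (\<phi> + 1) = P \<phi> [1]\<close> refers to the
  essential image under the shift.\<close>

definition additive_subcategory :: "('o, 'm) tricat \<Rightarrow> 'o set \<Rightarrow> bool" where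
  "additive_subcategory C A \<longleftrightarrow> A \<subseteq> Ob C \<and>
     (\<forall>x\<in>A. \<forall>y. isomorphic C x y \<longrightarrow> y \<in> A) \<and>
     (\<forall>z. zero_object C z \<longrightarrow> z \<in> A) \<and>
     (\<forall>x\<in>A. \<forall>y\<in>A. \<forall>s. is_binary_sum C x y s \<longrightarrow> s \<in> A)"

definition is_slicing :: "('o, 'm) tricat \<Rightarrow> 'o slicing \<Rightarrow> bool" where
  "is_slicing C P \<longleftrightarrow>
     (\<forall>\<phi>. additive_subcategory C (P \<phi>)) \<and>
     (\<forall>\<phi>. P (\<phi> + 1) = {y. \<exists>x\<in>P \<phi>. isomorphic C (shO C x) y}) \<and>
     (\<forall>\<phi> \<psi>. \<psi> < \<phi> \<longrightarrow> (\<forall>x\<in>P \<phi>. \<forall>y\<in>P \<psi>. Hom C x y = {zerom C x y})) \<and>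
     (\<forall>y\<in>Ob C. \<not> zero_object C y \<longrightarrow> (\<exists>n x a \<phi>. HN_filtration C P y n x a \<phi>))"

inductive_set extension_closure :: "('o, 'm) tricat \<Rightarrow> 'o set \<Rightarrow> 'o set"
  for C :: "('o, 'm) tricat" and A :: "'o set"
  where
    zero: "zero_object C z \<Longrightarrow> z \<in> extension_closure C A"
  | base: "x \<in> A \<Longrightarrow> x \<in> extension_closure C A"
  | extension: "x \<in> extension_closure C A \<Longrightarrow> z \<in> extension_closure C A \<Longrightarrow>
                  ex_triangle C x y z \<Longrightarrow> y \<in> extension_closure C A"

definition slice :: "('o, 'm) tricat \<Rightarrow> 'o slicing \<Rightarrow> real set \<Rightarrow> 'o set" where
  "slice C P I = extension_closure C (\<Union>\<phi>\<in>I. P \<phi>)"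

text \<open>Finite length of a quasi-abelian category refers to chains of strict subobjects. The strict
  monomorphisms of a quasi-abelian category are those morphisms that are kernels of morphisms.
  Kernels are taken in the full subcategory \<open>A\<close>, not in \<open>C\<close>.\<close>

definition is_kernel_in ::
  "('o, 'm) tricat \<Rightarrow> 'o set \<Rightarrow> 'o \<Rightarrow> 'o \<Rightarrow> 'o \<Rightarrow> 'm \<Rightarrow> 'm \<Rightarrow> bool" where
  "is_kernel_in C A k x y i f \<longleftrightarrow> k \<in> A \<and> x \<in> A \<and> y \<in> A \<and>
     i \<in> Hom C k x \<and> f \<in> Hom C x y \<and> f \<diamondop>\<^bsub>C\<^esub> i = zerom C k y \<and>
     (\<forall>w\<in>A. \<forall>g\<in>Hom C w x. f \<diamondop>\<^bsub>C\<^esub> g = zerom C w y \<longrightarrow>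
        (\<exists>!h. h \<in> Hom C w k \<and> i \<diamondop>\<^bsub>C\<^esub> h = g))"

definition strict_subobject :: "('o, 'm) tricat \<Rightarrow> 'o set \<Rightarrow> 'o \<Rightarrow> 'o \<Rightarrow> 'm \<Rightarrow> bool" where
  "strict_subobject C A x k i \<longleftrightarrow> (\<exists>y f. is_kernel_in C A k x y i f)"

text \<open>Inclusion of subobjects \<open>i : k \<rightarrow> x\<close> and \<open>i' : k' \<rightarrow> x\<close>; mutual inclusion is equality.\<close>

definition subobject_le :: "('o, 'm) tricat \<Rightarrow> 'o \<Rightarrow> 'm \<Rightarrow> 'o \<Rightarrow> 'm \<Rightarrow> bool" where
  "subobject_le C k i k' i' \<longleftrightarrow> (\<exists>h\<in>Hom C k k'. i' \<diamondop>\<^bsub>C\<^esub> h = i)"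

definition finite_length :: "('o, 'm) tricat \<Rightarrow> 'o set \<Rightarrow> bool" where
  "finite_length C A \<longleftrightarrow> (\<forall>x\<in>A. \<forall>k i. (\<forall>n::nat. strict_subobject C A x (k n) (i n)) \<longrightarrow>
     ((\<forall>n. subobject_le C (k n) (i n) (k (Suc n)) (i (Suc n))) \<longrightarrow>
        (\<exists>N. \<forall>n\<ge>N. subobject_le C (k (Suc n)) (i (Suc n)) (k n) (i n))) \<and>
     ((\<forall>n. subobject_le C (k (Suc n)) (i (Suc n)) (k n) (i n)) \<longrightarrow>
        (\<exists>N. \<forall>n\<ge>N. subobject_le C (k n) (i n) (k (Suc n)) (i (Suc n)))))"

text \<open>The bound \<open>\<eta> < 1 / 2\<close> ensures that the slices are quasi-abelian.\<close>

definition locally_finite :: "('o, 'm) tricat \<Rightarrow> 'o slicing \<Rightarrow> bool" where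
  "locally_finite C P \<longleftrightarrow>
     (\<exists>\<eta>. 0 < \<eta> \<and> \<eta> < 1 / 2 \<and> (\<forall>t. finite_length C (slice C P {t - \<eta> <..< t + \<eta>})))"

text \<open>The extensionality condition makes a central charge determined by its values on the
  Grothendieck group.\<close>

definition Stab :: "('o, 'm) tricat \<Rightarrow> 'o stability set" where
  "Stab C = {(P, Z). is_slicing C P \<and>
     Z \<in> hom (K0 C) complex_group \<and> Z \<in> extensional (carrier (K0 C)) \<and>
     (\<forall>\<phi>. \<forall>x\<in>P \<phi>. \<not> zero_object C x \<longrightarrow>
        (\<exists>m>0. Z (K0_class C x) = complex_of_real m * cis (pi * \<phi>))) \<and>
     locally_finite C P}"

definition C_action :: "('o, 'm) tricat \<Rightarrow> complex \<Rightarrow> 'o stability \<Rightarrow> 'o stability" where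
  "C_action C \<omega> \<tau> =
     (\<lambda>\<phi>. fst \<tau> (\<phi> - Im \<omega> / pi), \<lambda>\<kappa>\<in>carrier (K0 C). exp \<omega> * snd \<tau> \<kappa>)"

definition C_orbit_rel :: "('o, 'm) tricat \<Rightarrow> ('o stability \<times> 'o stability) set" where
  "C_orbit_rel C = {(\<tau>, \<tau>') \<in> Stab C \<times> Stab C. \<exists>\<omega>. \<tau>' = C_action C \<omega> \<tau>}"

definition Stab_mod_C :: "('o, 'm) tricat \<Rightarrow> 'o stability set set" where
  "Stab_mod_C C = Stab C // C_orbit_rel C"

definition mass :: "('o, 'm) tricat \<Rightarrow> real \<Rightarrow> 'o stability \<Rightarrow> 'o \<Rightarrow> real" where
  "mass C q \<tau> y = (THE m. \<exists>n x a \<phi>. HN_filtration C (fst \<tau>) y n x a \<phi> \<and>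
     m = (\<Sum>i<n. q powr \<phi> i * cmod (snd \<tau> (K0_class C (a i)))))"

definition quotient_topology :: "'a topology \<Rightarrow> ('a \<Rightarrow> 'b) \<Rightarrow> 'b topology" where
  "quotient_topology X f =
     topology (\<lambda>U. U \<subseteq> f ` topspace X \<and> openin X {x \<in> topspace X. f x \<in> U})"

lemma openin_quotient_topology:
  "openin (quotient_topology X f) U \<longleftrightarrow>
     U \<subseteq> f ` topspace X \<and> openin X {x \<in> topspace X. f x \<in> U}"
proof -
  have "istopology (\<lambda>U. U \<subseteq> f ` topspace X \<and> openin X {x \<in> topspace X. f x \<in> U})"
    unfolding istopology_def
  proof (intro conjI allI impI)
    fix U V
    assume U: "U \<subseteq> f ` topspace X \<and> openin X {x \<in> topspace X. f x \<in> U}"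
      and V: "V \<subseteq> f ` topspace X \<and> openin X {x \<in> topspace X. f x \<in> V}"
    show "U \<inter> V \<subseteq> f ` topspace X" using U by blast
    have "{x \<in> topspace X. f x \<in> U \<inter> V} =
            {x \<in> topspace X. f x \<in> U} \<inter> {x \<in> topspace X. f x \<in> V}" by blast
    then show "openin X {x \<in> topspace X. f x \<in> U \<inter> V}" using U V by (simp add: openin_Int)
  next
    fix \<K>
    assume K: "\<forall>K\<in>\<K>. K \<subseteq> f ` topspace X \<and> openin X {x \<in> topspace X. f x \<in> K}"
    show "\<Union>\<K> \<subseteq> f ` topspace X" using K by blast
    have "{x \<in> topspace X. f x \<in> \<Union>\<K>} = (\<Union>K\<in>\<K>. {x \<in> topspace X. f x \<in> K})" by blast
    then show "openin X {x \<in> topspace X. f x \<in> \<Union>\<K>}" using K by auto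
  qed
  then show ?thesis by (simp add: quotient_topology_def)
qed

lemma topspace_quotient_topology: "topspace (quotient_topology X f) = f ` topspace X"
proof
  show "topspace (quotient_topology X f) \<subseteq> f ` topspace X"
    using openin_topspace[of "quotient_topology X f"] unfolding openin_quotient_topology
    by (rule conjunct1)
  have "{x \<in> topspace X. f x \<in> f ` topspace X} = topspace X" by blast
  then have "openin (quotient_topology X f) (f ` topspace X)"
    by (simp add: openin_quotient_topology)
  then show "f ` topspace X \<subseteq> topspace (quotient_topology X f)"
    by (rule openin_subset)
qed

lemma quotient_map_quotient_topology: "quotient_map X (quotient_topology X f) f"
  unfolding quotient_map_def topspace_quotient_topology
  by (auto simp: openin_quotient_topology)

text \<open>Functions on \<open>S\<close> are functions on the whole type that are \<open>undefined\<close> outside \<open>S\<close>, as in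
  the topological space \<open>powertop_real S\<close>.  A point of the projective space is a set of
  functions, namely a line without the origin.\<close>

definition punctured :: "'o set \<Rightarrow> ('o \<Rightarrow> real) topology" where
  "punctured S = subtopology (powertop_real S) (- {\<lambda>s\<in>S. 0})"

definition proj_class :: "'o set \<Rightarrow> ('o \<Rightarrow> real) \<Rightarrow> ('o \<Rightarrow> real) set" where
  "proj_class S f = {\<lambda>s\<in>S. c * f s | c. c \<noteq> 0}"

definition projective_space :: "'o set \<Rightarrow> ('o \<Rightarrow> real) set topology" where
  "projective_space S = quotient_topology (punctured S) (proj_class S)"

text \<open>The class of \<open>\<tau> \<mapsto> mass C q \<tau>\<close> is constant on orbits, so the image of an orbit is a singleton.\<close>

definition mass_map ::
  "('o, 'm) tricat \<Rightarrow> real \<Rightarrow> 'o set \<Rightarrow> 'o stability set \<Rightarrow> ('o \<Rightarrow> real) set" where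
  "mass_map C q S orb = the_elem ((\<lambda>\<tau>. proj_class S (\<lambda>s\<in>S. mass C q \<tau> s)) ` orb)"

end

theory Submission
  imports Defs
begin

text \<open>
  For a stability condition with slicing \<open>P\<close> and a real \<open>t\<close>, let \<open>H\<^sub>t y\<close> be the cohomology of \<open>y\<close> in
  the heart \<open>P(t, t + 1]\<close>, on which the height \<open>h\<^sub>t = Im (exp (-i \<pi> t) Z)\<close> is additive and non-negative.
  A semistable object of phase \<open>\<phi>\<close> contributes
  \<open>\<integral> q\<^sup>t |Z| sin (\<pi> (\<phi> - t)) dt\<close> over \<open>[\<phi> - 1, \<phi>]\<close>, a constant multiple of \<open>q\<^sup>\<phi> |Z|\<close>, to
  \<open>\<integral> q\<^sup>t h\<^sub>t (H\<^sub>t y) dt\<close>, so this integral is a constant multiple of the mass of \<open>y\<close>.  As the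
  integrand does not mention Harder--Narasimhan filtrations, the mass is well defined; as \<open>h\<^sub>t \<circ> H\<^sub>t\<close> is
  subadditive on triangles and monotone under retracts, so is the mass.  Hence on each object \<open>s\<close> the
  mass is at most \<open>K s\<close> times the sum of the masses of the \<open>p\<^sub>i\<close>, with \<open>K s\<close> independent of the
  stability condition.  The lines spanned by functions satisfying these bounds form a closed set, which
  is the image of the compact set of those non-negative ones whose values at the \<open>p\<^sub>i\<close> sum to \<open>1\<close>.
\<close>

section \<open>Triangles\<close>

text \<open>The obstacle is that the Harder--Narasimhan filtrations of the three vertices of a
  triangle are hardly related, so masses cannot be compared term by term. Truncations at a single
  \<open>t\<close> are related, and there the height is additive; averaging over \<open>t\<close>
  recovers the mass. The weight \<open>q powr t\<close> is forced: exponentials are eigenfunctions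
  of convolution with a fixed kernel, here half a period of the sine, and the eigenvalue is
  positive, so inequalities may be divided by it.

  The hearts are never shown to be abelian, and no cohomology functor is built. A cohomology object
  is any object fitting into suitable triangles, and short exact sequences in the heart appear as
  triangles with all vertices in it; the octahedral axiom, read as associativity of extensions, does
  the rest.

  Projective space is not treated as a Hausdorff space, so closedness of a compact set has to come
  from the quotient topology: its preimage in the punctured product is cut out by closed conditions.
  That preimage contains \<open>- f\<close> with \<open>f\<close>, hence two copies of every
  inequality.\<close>

context additive_category
begin

section \<open>Morphism groups, isomorphisms and retracts\<close>

abbreviation neg :: "'o \<Rightarrow> 'o \<Rightarrow> 'm \<Rightarrow> 'm" where
  "neg x y f \<equiv> inv\<^bsub>hom_group C x y\<^esub> f"

lemma hom_group_simps [simp]: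
  "carrier (hom_group C x y) = Hom C x y"
  "f \<otimes>\<^bsub>hom_group C x y\<^esub> g = addm C f g"
  "\<one>\<^bsub>hom_group C x y\<^esub> = zerom C x y"
  by (simp_all add: hom_group_def)

lemma zero_closed: "x \<in> Ob C \<Longrightarrow> y \<in> Ob C \<Longrightarrow> zerom C x y \<in> Hom C x y"
  using monoid.one_closed[OF group.is_monoid[OF comm_group.axioms(2)[OF hom_comm_group]], of x y] by simp

lemma hom_group_group: "f \<in> Hom C x y \<Longrightarrow> group (hom_group C x y)"
  using comm_group.axioms(2)[OF hom_comm_group] hom_ob by blast

lemma neg_closed: "f \<in> Hom C x y \<Longrightarrow> neg x y f \<in> Hom C x y"
  using group.inv_closed[OF hom_group_group, of f x y f] by simp

lemma add_neg: "f \<in> Hom C x y \<Longrightarrow> addm C f (neg x y f) = zerom C x y"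
  using group.r_inv[OF hom_group_group, of f x y f] by simp

lemma add_closed: "f \<in> Hom C x y \<Longrightarrow> g \<in> Hom C x y \<Longrightarrow> addm C f g \<in> Hom C x y"
  using monoid.m_closed[OF group.is_monoid[OF hom_group_group], of f x y f g] by simp

lemma zero_add: "f \<in> Hom C x y \<Longrightarrow> addm C (zerom C x y) f = f"
  using monoid.l_one[OF group.is_monoid[OF hom_group_group], of f x y f] by simp

lemma neg_neg: "f \<in> Hom C x y \<Longrightarrow> neg x y (neg x y f) = f"
  using group.inv_inv[OF hom_group_group, of f x y f] by simp

lemma neg_unique:
  assumes "f \<in> Hom C x y" "g \<in> Hom C x y" "addm C f g = zerom C x y" shows "g = neg x y f"
proof -
  have "comm_group (hom_group C x y)" using assms hom_ob hom_comm_group by blast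
  then interpret comm_group "hom_group C x y" .
  have "addm C g f = zerom C x y" using m_comm[of f g] assms by simp
  then show ?thesis using inv_equality[of g f] assms by simp
qed

lemma add_idem: "f \<in> Hom C x y \<Longrightarrow> addm C f f = f \<Longrightarrow> f = zerom C x y"
  using group.l_cancel_one[OF hom_group_group, of f x y f f] by simp

lemma add_neg_eq:
  assumes "f \<in> Hom C x y" "g \<in> Hom C x y" "addm C f (neg x y g) = zerom C x y" shows "f = g"
  using neg_unique[OF assms(1) neg_closed[OF assms(2)] assms(3)] neg_neg assms(1,2) by metis

lemma cmp_zero_right:
  assumes "x \<in> Ob C" "g \<in> Hom C y z" shows "g \<diamondop> zerom C x y = zerom C x z"
proof -
  have z: "zerom C x y \<in> Hom C x y" using assms hom_ob zero_closed by blast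
  show ?thesis
    using cmp_add_right[OF z z assms(2)] zero_add[OF z] add_idem[OF cmp_closed[OF z assms(2)]] by simp
qed

lemma cmp_zero_left:
  assumes "z \<in> Ob C" "f \<in> Hom C x y" shows "zerom C y z \<diamondop> f = zerom C x z"
proof -
  have z: "zerom C y z \<in> Hom C y z" using assms hom_ob zero_closed by blast
  show ?thesis
    using cmp_add_left[OF assms(2) z z] zero_add[OF z] add_idem[OF cmp_closed[OF assms(2) z]] by simp
qed

lemma cmp_neg_right:
  assumes "f \<in> Hom C x y" "g \<in> Hom C y z" shows "g \<diamondop> neg x y f = neg x z (g \<diamondop> f)"
proof (rule neg_unique)
  show "addm C (g \<diamondop> f) (g \<diamondop> neg x y f) = zerom C x z"
    using cmp_add_right[OF assms(1) neg_closed[OF assms(1)] assms(2)] add_neg[OF assms(1)]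
      cmp_zero_right[of x g y z] hom_ob[OF assms(1)] assms(2) by simp
qed (use assms cmp_closed neg_closed in blast)+

lemma cmp_neg_left:
  assumes "f \<in> Hom C x y" "g \<in> Hom C y z" shows "neg y z g \<diamondop> f = neg x z (g \<diamondop> f)"
proof (rule neg_unique)
  show "addm C (g \<diamondop> f) (neg y z g \<diamondop> f) = zerom C x z"
    using cmp_add_left[OF assms neg_closed[OF assms(2)]] add_neg[OF assms(2)]
      cmp_zero_left[of z f x y] hom_ob[OF assms(2)] assms(1) by simp
qed (use assms cmp_closed neg_closed in blast)+

lemma neg_inj: "f \<in> Hom C x y \<Longrightarrow> g \<in> Hom C x y \<Longrightarrow> neg x y f = neg x y g \<Longrightarrow> f = g"
  using neg_neg by metis

lemma zero_object_ob: "zero_object C z \<Longrightarrow> z \<in> Ob C"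
  unfolding zero_object_def by blast

lemma zero_object_hom:
  assumes "zero_object C z" "x \<in> Ob C"
  shows "f \<in> Hom C x z \<longleftrightarrow> f = zerom C x z" "f \<in> Hom C z x \<longleftrightarrow> f = zerom C z x"
  using assms zero_closed unfolding zero_object_def by metis+

lemma zero_object_iff_id: "x \<in> Ob C \<Longrightarrow> zero_object C x \<longleftrightarrow> idm C x = zerom C x x"
proof
  assume x: "x \<in> Ob C" and z: "idm C x = zerom C x x"
  have "f = zerom C x y" if "f \<in> Hom C x y" for f y
    using that cmp_id_right[OF that] z cmp_zero_right[OF x that] by simp
  moreover have "f = zerom C y x" if "f \<in> Hom C y x" for f y
    using that cmp_id_left[OF that] z cmp_zero_left[OF x that] by simp
  ultimately show "zero_object C x"
    unfolding zero_object_def using x zero_closed by metis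
qed (use zero_object_hom id_closed in blast)

lemma is_iso_id: "x \<in> Ob C \<Longrightarrow> is_iso C x x (idm C x)"
  unfolding is_iso_def using id_closed cmp_id_left by blast

lemma isomorphic_refl: "x \<in> Ob C \<Longrightarrow> isomorphic C x x"
  unfolding isomorphic_def using is_iso_id by blast

lemma isomorphic_sym: "isomorphic C x y \<Longrightarrow> isomorphic C y x"
  unfolding isomorphic_def is_iso_def by blast

lemma isomorphic_ob: "isomorphic C x y \<Longrightarrow> x \<in> Ob C \<and> y \<in> Ob C"
  unfolding isomorphic_def is_iso_def by blast

lemma is_iso_cmp:
  assumes "is_iso C x y f" "is_iso C y z g" shows "is_iso C x z (g \<diamondop> f)"
proof -
  obtain f' where f: "f \<in> Hom C x y" "f' \<in> Hom C y x" "f' \<diamondop> f = idm C x" "f \<diamondop> f' = idm C y"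
    using assms(1) unfolding is_iso_def by blast
  obtain g' where g: "g \<in> Hom C y z" "g' \<in> Hom C z y" "g' \<diamondop> g = idm C y" "g \<diamondop> g' = idm C z"
    using assms(2) unfolding is_iso_def by blast
  have "(f' \<diamondop> g') \<diamondop> (g \<diamondop> f) = idm C x"
    using cmp_assoc[OF cmp_closed[OF f(1) g(1)] g(2) f(2)] cmp_assoc[OF f(1) g(1) g(2)]
      cmp_id_left[OF f(1)] f(3) g(3) by simp
  moreover have "(g \<diamondop> f) \<diamondop> (f' \<diamondop> g') = idm C z"
    using cmp_assoc[OF cmp_closed[OF g(2) f(2)] f(1) g(1)] cmp_assoc[OF g(2) f(2) f(1)]
      cmp_id_left[OF g(2)] f(4) g(4) by simp
  ultimately show ?thesis
    unfolding is_iso_def using f g cmp_closed hom_ob by blast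
qed

lemma isomorphic_trans: "isomorphic C x y \<Longrightarrow> isomorphic C y z \<Longrightarrow> isomorphic C x z"
  unfolding isomorphic_def using is_iso_cmp by blast

lemma zero_object_iso:
  assumes "isomorphic C x y" "zero_object C x" shows "zero_object C y"
proof -
  obtain f g where f: "f \<in> Hom C x y" "g \<in> Hom C y x" "f \<diamondop> g = idm C y"
    using assms(1) unfolding isomorphic_def is_iso_def by blast
  have ob: "x \<in> Ob C" "y \<in> Ob C" using hom_ob[OF f(1)] by auto
  have "f = zerom C x y" using zero_object_hom(2)[OF assms(2) ob(2)] f(1) by blast
  then have "idm C y = zerom C y y" using f(3) cmp_zero_left[OF ob(2) f(2)] by simp
  then show ?thesis using zero_object_iff_id ob by blast
qed

definition hom_zero :: "'o \<Rightarrow> 'o \<Rightarrow> bool" where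
  "hom_zero x y \<longleftrightarrow> Hom C x y = {zerom C x y}"

lemma hom_zero_iff: "x \<in> Ob C \<Longrightarrow> y \<in> Ob C \<Longrightarrow> hom_zero x y \<longleftrightarrow> (\<forall>f\<in>Hom C x y. f = zerom C x y)"
  unfolding hom_zero_def using zero_closed by blast

lemma hom_zeroD: "hom_zero x y \<Longrightarrow> f \<in> Hom C x y \<Longrightarrow> f = zerom C x y"
  unfolding hom_zero_def by blast

lemma hom_zero_iso_left:
  assumes "isomorphic C x x'" "hom_zero x y" "y \<in> Ob C" shows "hom_zero x' y"
proof -
  obtain f f' where f: "f \<in> Hom C x x'" "f' \<in> Hom C x' x" "f \<diamondop> f' = idm C x'"
    using assms(1) unfolding isomorphic_def is_iso_def by blast
  have "h = zerom C x' y" if h: "h \<in> Hom C x' y" for h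
  proof -
    have "h \<diamondop> f = zerom C x y" using cmp_closed[OF f(1) h] assms(2) hom_zeroD by blast
    moreover have "h = (h \<diamondop> f) \<diamondop> f'" using cmp_assoc[OF f(2,1) h] f(3) cmp_id_right[OF h] by simp
    ultimately show ?thesis using cmp_zero_left[OF assms(3) f(2)] by simp
  qed
  then show ?thesis using hom_zero_iff assms isomorphic_ob by blast
qed

lemma hom_zero_iso_right:
  assumes "isomorphic C y y'" "hom_zero x y" "x \<in> Ob C" shows "hom_zero x y'"
proof -
  obtain f f' where f: "f \<in> Hom C y y'" "f' \<in> Hom C y' y" "f \<diamondop> f' = idm C y'"
    using assms(1) unfolding isomorphic_def is_iso_def by blast
  have "h = zerom C x y'" if h: "h \<in> Hom C x y'" for h
  proof -
    have "f' \<diamondop> h = zerom C x y" using cmp_closed[OF h f(2)] assms(2) hom_zeroD by blast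
    moreover have "h = f \<diamondop> (f' \<diamondop> h)" using cmp_assoc[OF h f(2,1)] f(3) cmp_id_left[OF h] by simp
    ultimately show ?thesis using cmp_zero_right[OF assms(3) f(1)] by simp
  qed
  then show ?thesis using hom_zero_iff assms isomorphic_ob by blast
qed

text \<open>No complement is recorded: two maps whose composite is the identity can be carried
  through truncations one at a time.\<close>

definition retract :: "'o \<Rightarrow> 'o \<Rightarrow> bool" where
  "retract x y \<longleftrightarrow> (\<exists>i\<in>Hom C x y. \<exists>r\<in>Hom C y x. r \<diamondop> i = idm C x)"

lemma retract_refl: "x \<in> Ob C \<Longrightarrow> retract x x"
  unfolding retract_def using id_closed cmp_id_left by blast

lemma direct_summand_retract: "direct_summand C y x \<Longrightarrow> retract y x"
proof -
  assume "direct_summand C y x"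
  then obtain y' inj pr where
    "\<forall>i\<in>UNIV. inj i \<in> Hom C (case_bool y y' i) x \<and> pr i \<in> Hom C x (case_bool y y' i)"
    "\<forall>i\<in>UNIV. \<forall>j\<in>UNIV. pr j \<diamondop> inj i =
       (if i = j then idm C (case_bool y y' i) else zerom C (case_bool y y' i) (case_bool y y' j))"
    unfolding direct_summand_def is_binary_sum_def is_direct_sum_def by blast
  then have "inj True \<in> Hom C y x" "pr True \<in> Hom C x y" "pr True \<diamondop> inj True = idm C y"
    by (metis UNIV_I bool.case(1))+
  then show "retract y x" unfolding retract_def by blast
qed

end

section \<open>Exactness, rotation and the octahedral axiom\<close>

context triangulated_category
begin

abbreviation tri :: "'a \<Rightarrow> 'a \<Rightarrow> 'a \<Rightarrow> bool" where "tri \<equiv> ex_triangle C"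

abbreviation sh :: "'a \<Rightarrow> 'a" where "sh \<equiv> shO C"

lemma sh_hom: "f \<in> Hom C x y \<Longrightarrow> shM C f \<in> Hom C (sh x) (sh y)"
  using bij_betwE[OF sh_fully_faithful[of x y]] hom_ob by blast

lemma sh_full: "g \<in> Hom C (sh x) (sh y) \<Longrightarrow> x \<in> Ob C \<Longrightarrow> y \<in> Ob C \<Longrightarrow> \<exists>f\<in>Hom C x y. shM C f = g"
  using sh_fully_faithful[of x y] unfolding bij_betw_def by (metis imageE)

lemma sh_faithful: "f \<in> Hom C x y \<Longrightarrow> g \<in> Hom C x y \<Longrightarrow> shM C f = shM C g \<Longrightarrow> f = g"
  using sh_fully_faithful[of x y] hom_ob[of f x y] unfolding bij_betw_def inj_on_def by blast

lemma sh_zero: "x \<in> Ob C \<Longrightarrow> y \<in> Ob C \<Longrightarrow> shM C (zerom C x y) = zerom C (sh x) (sh y)"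
  using sh_add[of "zerom C x y" x y "zerom C x y"] zero_closed zero_add
    add_idem[OF sh_hom] by metis

lemma zero_object_sh: "x \<in> Ob C \<Longrightarrow> zero_object C (sh x) \<longleftrightarrow> zero_object C x"
  using zero_object_iff_id sh_ob sh_id sh_zero sh_faithful id_closed zero_closed by metis

lemma isomorphic_sh_iff:
  assumes "x \<in> Ob C" "y \<in> Ob C" shows "isomorphic C (sh x) (sh y) \<longleftrightarrow> isomorphic C x y"
proof
  assume "isomorphic C (sh x) (sh y)"
  then obtain f' g' where "f' \<in> Hom C (sh x) (sh y)" "g' \<in> Hom C (sh y) (sh x)"
      "g' \<diamondop> f' = idm C (sh x)" "f' \<diamondop> g' = idm C (sh y)"
    unfolding isomorphic_def is_iso_def by blast
  moreover from this obtain f g where fg: "f \<in> Hom C x y" "g \<in> Hom C y x" "shM C f = f'" "shM C g = g'"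
    using sh_full assms by metis
  ultimately have "g \<diamondop> f = idm C x" "f \<diamondop> g = idm C y"
    using sh_faithful[OF cmp_closed[OF fg(1,2)] id_closed] sh_faithful[OF cmp_closed[OF fg(2,1)] id_closed]
      sh_cmp sh_id assms by metis+
  then show "isomorphic C x y"
    unfolding isomorphic_def is_iso_def using fg assms by blast
next
  assume "isomorphic C x y"
  then obtain f g where "f \<in> Hom C x y" "g \<in> Hom C y x" "g \<diamondop> f = idm C x" "f \<diamondop> g = idm C y"
    unfolding isomorphic_def is_iso_def by blast
  then show "isomorphic C (sh x) (sh y)"
    unfolding isomorphic_def is_iso_def
    using sh_hom sh_ob sh_cmp[of f x y g x] sh_cmp[of g y x f y] sh_id assms by metis
qed

lemma hom_zero_sh:
  assumes "x \<in> Ob C" "y \<in> Ob C" shows "hom_zero (sh x) (sh y) \<longleftrightarrow> hom_zero x y"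
  using hom_zero_iff[OF assms] hom_zero_iff[OF sh_ob[OF assms(1)] sh_ob[OF assms(2)]]
    sh_full[OF _ assms] sh_hom sh_faithful sh_zero[OF assms] zero_closed[OF assms] by metis

lemma tri_ob: "tri x y z \<Longrightarrow> x \<in> Ob C \<and> y \<in> Ob C \<and> z \<in> Ob C"
  unfolding ex_triangle_def using dist_typed hom_ob by metis

lemma dist_rotate:
  "tricat.dist C x y z f g h \<Longrightarrow> tricat.dist C y z (sh x) g h (neg (sh x) (sh y) (shM C f))"
  using TR2 dist_typed by blast

text \<open>Since \<open>sh z\<close> is again a zero object, rotating this triangle gives the
  identity triangle of \<open>w\<close>. \<open>TR2\<close> is read backwards, and its sign is
  harmless because only one map leaves a zero object.\<close>

lemma dist_zero_left:
  assumes "w \<in> Ob C" "zero_object C z"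
  shows "tricat.dist C z w w (zerom C z w) (idm C w) (zerom C w (sh z))"
proof -
  have z: "z \<in> Ob C" "zero_object C (sh z)"
    using assms zero_object_def zero_object_sh by metis+
  have "neg (sh z) (sh w) (shM C (zerom C z w)) = zerom C (sh z) (sh w)"
    using zero_object_hom(2)[OF z(2) sh_ob[OF assms(1)]] neg_closed[OF sh_hom[OF zero_closed[OF z(1) assms(1)]]]
    by blast
  then show ?thesis
    using TR2[of "zerom C z w" z w "idm C w" w "zerom C w (sh z)"] TR1_id[OF assms(1) z(2)]
      zero_closed id_closed assms(1) z(1) sh_ob by auto
qed

text \<open>The identity triangle of \<open>x\<close> maps to the given one by \<open>TR3\<close>,
  so the composite factors through a zero object.\<close>

lemma dist_cmp_zero:
  assumes "tricat.dist C x y z f g h" shows "g \<diamondop> f = zerom C x z"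
proof -
  have t: "f \<in> Hom C x y" "g \<in> Hom C y z" using dist_typed[OF assms] by auto
  have ob: "x \<in> Ob C" "z \<in> Ob C" using t hom_ob by auto
  obtain o' where o': "zero_object C o'" using ex_zero_object by blast
  obtain c where c: "c \<in> Hom C o' z" "c \<diamondop> zerom C x o' = g \<diamondop> f"
    using TR3[OF TR1_id[OF ob(1) o'] assms id_closed[OF ob(1)] t(1)] by blast
  then show ?thesis using cmp_zero_right[OF ob(1)] by metis
qed

text \<open>Exactness of Hom(w, -) at \<open>y\<close>. \<open>TR3\<close> only fills in the third
  map, so both triangles are rotated until the missing map stands third; it is then desuspended by
  fullness of the shift, and the signs of the two rotations cancel.\<close>

lemma dist_lift:
  assumes "tricat.dist C x y z f g h" "k \<in> Hom C w y" "g \<diamondop> k = zerom C w z"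
  shows "\<exists>l\<in>Hom C w x. f \<diamondop> l = k"
proof -
  have t: "f \<in> Hom C x y" "g \<in> Hom C y z" "h \<in> Hom C z (sh x)" using dist_typed[OF assms(1)] by auto
  have ob: "x \<in> Ob C" "y \<in> Ob C" "z \<in> Ob C" "w \<in> Ob C" using t assms(2) hom_ob by auto
  obtain o' where o': "zero_object C o'" using ex_zero_object by blast
  have o'': "o' \<in> Ob C" using zero_object_ob[OF o'] .
  have "zerom C o' z \<diamondop> zerom C w o' = g \<diamondop> k"
    using assms(3) cmp_zero_right zero_closed ob o'' by metis
  then obtain c where c: "c \<in> Hom C (sh w) (sh x)"
      "shM C k \<diamondop> neg (sh w) (sh w) (shM C (idm C w)) = neg (sh x) (sh y) (shM C f) \<diamondop> c"
    using TR3[OF dist_rotate[OF TR1_id[OF ob(4) o']] dist_rotate[OF assms(1)] assms(2) zero_closed[OF o'' ob(3)]]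
    by blast
  obtain l where l: "l \<in> Hom C w x" "shM C l = c" using sh_full[OF c(1)] ob by blast
  have "neg (sh w) (sh y) (shM C k) = neg (sh w) (sh y) (shM C f \<diamondop> c)"
    using c(2) cmp_neg_left[OF c(1) sh_hom[OF t(1)]] cmp_neg_right[OF id_closed[OF sh_ob[OF ob(4)]] sh_hom[OF assms(2)]]
      cmp_id_right[OF sh_hom[OF assms(2)]] sh_id[OF ob(4)] by simp
  then have "shM C k = shM C f \<diamondop> c"
    using neg_inj sh_hom[OF assms(2)] cmp_closed[OF c(1) sh_hom[OF t(1)]] by blast
  then have "shM C (f \<diamondop> l) = shM C k" using sh_cmp[OF l(1) t(1)] l(2) by simp
  then show ?thesis using sh_faithful cmp_closed[OF l(1) t(1)] assms(2) l(1) by blast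
qed

text \<open>Exactness of Hom(-, w) at \<open>y\<close>; the missing map already stands third once
  \<open>0 -> w -> w\<close> is the target triangle.\<close>

lemma dist_extend:
  assumes "tricat.dist C x y z f g h" "k \<in> Hom C y w" "k \<diamondop> f = zerom C x w"
  shows "\<exists>l\<in>Hom C z w. l \<diamondop> g = k"
proof -
  have t: "f \<in> Hom C x y" "g \<in> Hom C y z" "h \<in> Hom C z (sh x)" using dist_typed[OF assms(1)] by auto
  have ob: "x \<in> Ob C" "y \<in> Ob C" "z \<in> Ob C" "w \<in> Ob C" using t assms(2) hom_ob by auto
  obtain o' where o': "zero_object C o'" using ex_zero_object by blast
  have o'': "o' \<in> Ob C" using zero_object_ob[OF o'] .
  have "k \<diamondop> f = zerom C o' w \<diamondop> zerom C x o'"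
    using assms(3) cmp_zero_right zero_closed ob o'' by metis
  then obtain c where "c \<in> Hom C z w" "c \<diamondop> g = idm C w \<diamondop> k"
    using TR3[OF assms(1) dist_zero_left[OF ob(4) o'] zero_closed[OF ob(1) o''] assms(2)] by blast
  then show ?thesis using cmp_id_left[OF assms(2)] by auto
qed

lemma dist_iso:
  assumes "tricat.dist C x y z f g h" "is_iso C x x' a" "is_iso C y y' b" "is_iso C z z' c"
  shows "tri x' y' z'"
proof -
  have t: "f \<in> Hom C x y" "g \<in> Hom C y z" "h \<in> Hom C z (sh x)" using dist_typed[OF assms(1)] by auto
  obtain a' where a: "a \<in> Hom C x x'" "a' \<in> Hom C x' x" "a' \<diamondop> a = idm C x"
    using assms(2) unfolding is_iso_def by blast
  obtain b' where b: "b \<in> Hom C y y'" "b' \<in> Hom C y' y" "b' \<diamondop> b = idm C y"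
    using assms(3) unfolding is_iso_def by blast
  obtain c' where c: "c \<in> Hom C z z'" "c' \<in> Hom C z' z" "c' \<diamondop> c = idm C z"
    using assms(4) unfolding is_iso_def by blast
  have f': "b \<diamondop> (f \<diamondop> a') \<in> Hom C x' y'" using a b t cmp_closed by blast
  have g': "c \<diamondop> (g \<diamondop> b') \<in> Hom C y' z'" using c b t cmp_closed by blast
  have h': "shM C a \<diamondop> (h \<diamondop> c') \<in> Hom C z' (sh x')" using a c t cmp_closed sh_hom by blast
  have "b \<diamondop> f = (b \<diamondop> (f \<diamondop> a')) \<diamondop> a"
    using cmp_assoc[OF a(1) cmp_closed[OF a(2) t(1)] b(1)] cmp_assoc[OF a(1,2) t(1)] a(3) cmp_id_right[OF t(1)] by simp
  moreover have "c \<diamondop> g = (c \<diamondop> (g \<diamondop> b')) \<diamondop> b"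
    using cmp_assoc[OF b(1) cmp_closed[OF b(2) t(2)] c(1)] cmp_assoc[OF b(1,2) t(2)] b(3) cmp_id_right[OF t(2)] by simp
  moreover have "shM C a \<diamondop> h = (shM C a \<diamondop> (h \<diamondop> c')) \<diamondop> c"
    using cmp_assoc[OF c(1) cmp_closed[OF c(2) t(3)] sh_hom[OF a(1)]] cmp_assoc[OF c(1,2) t(3)] c(3) cmp_id_right[OF t(3)] by simp
  ultimately show ?thesis
    unfolding ex_triangle_def using TR1_iso[OF assms(1) f' g' h' assms(2-4)] by blast
qed

lemma tri_iso:
  "tri x y z \<Longrightarrow> isomorphic C x x' \<Longrightarrow> isomorphic C y y' \<Longrightarrow> isomorphic C z z' \<Longrightarrow> tri x' y' z'"
  using dist_iso unfolding ex_triangle_def[of C x y z] isomorphic_def by blast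

lemma tri_rotate: "tri x y z \<Longrightarrow> tri y z (sh x)"
  unfolding ex_triangle_def using dist_rotate by blast

lemma tri_sh: "tri x y z \<Longrightarrow> tri (sh x) (sh y) (sh z)"
  using tri_rotate by blast

lemma tri_id: "x \<in> Ob C \<Longrightarrow> zero_object C z \<Longrightarrow> tri x x z"
  unfolding ex_triangle_def using TR1_id by blast

text \<open>The shift is onto only up to isomorphism, hence \<open>w\<close>. The map
  \<open>f\<close> itself is kept, not just the vertices, because \<open>truncation_retract\<close>
  factors a map annihilated by that very \<open>f\<close>.\<close>

lemma dist_unrotate:
  assumes "tricat.dist C x y z f g h"
  shows "\<exists>w u v. isomorphic C (sh w) z \<and> tricat.dist C w x y u f v"
proof -
  have t: "f \<in> Hom C x y" "g \<in> Hom C y z" "h \<in> Hom C z (sh x)" using dist_typed[OF assms] by auto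
  have ob: "x \<in> Ob C" "y \<in> Ob C" "z \<in> Ob C" using t hom_ob by auto
  obtain w where w: "w \<in> Ob C" "isomorphic C (sh w) z" using sh_ess_surj[OF ob(3)] by blast
  obtain c c' where c: "c \<in> Hom C (sh w) z" "c' \<in> Hom C z (sh w)" "c' \<diamondop> c = idm C (sh w)" "c \<diamondop> c' = idm C z"
    using w(2) unfolding isomorphic_def is_iso_def by blast
  have ic: "is_iso C z (sh w) c'" using c ob w sh_ob unfolding is_iso_def by blast
  have hc: "h \<diamondop> c \<in> Hom C (sh w) (sh x)" using cmp_closed[OF c(1) t(3)] .
  \<comment> \<open>This sign cancels against the one in \<open>TR2\<close>.\<close>
  obtain u where u: "u \<in> Hom C w x" "shM C u = neg (sh w) (sh x) (h \<diamondop> c)"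
    using sh_full[OF neg_closed[OF hc] w(1) ob(1)] by blast
  have "tricat.dist C x y (sh w) f (c' \<diamondop> g) (h \<diamondop> c)"
  proof (rule TR1_iso[OF assms t(1) cmp_closed[OF t(2) c(2)] hc is_iso_id[OF ob(1)] is_iso_id[OF ob(2)] ic])
    show "idm C y \<diamondop> f = f \<diamondop> idm C x" using cmp_id_left cmp_id_right t(1) by metis
    show "c' \<diamondop> g = (c' \<diamondop> g) \<diamondop> idm C y" using cmp_id_right[OF cmp_closed[OF t(2) c(2)]] by simp
    show "shM C (idm C x) \<diamondop> h = (h \<diamondop> c) \<diamondop> c'"
      using cmp_assoc[OF c(2,1) t(3)] c(4) cmp_id_right[OF t(3)] cmp_id_left[OF t(3)] sh_id[OF ob(1)] by simp
  qed
  then have "tricat.dist C w x y u f (c' \<diamondop> g)"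
    using TR2[OF u(1) t(1) cmp_closed[OF t(2) c(2)]] u(2) neg_neg[OF hc] by simp
  then show ?thesis using w by blast
qed

lemma tri_unrotate: "tri x y z \<Longrightarrow> \<exists>w. isomorphic C (sh w) z \<and> w \<in> Ob C \<and> tri w x y"
  using dist_unrotate tri_ob unfolding ex_triangle_def by metis

text \<open>Three backward rotations undo one shift; full faithfulness identifies the desuspended
  ends with \<open>x\<close> and \<open>z\<close>.\<close>

lemma tri_unsh:
  assumes "tri (sh x) k (sh z)" "x \<in> Ob C" "z \<in> Ob C"
  shows "\<exists>u. isomorphic C (sh u) k \<and> u \<in> Ob C \<and> tri x u z"
proof -
  obtain z' where z': "isomorphic C (sh z') (sh z)" "z' \<in> Ob C" "tri z' (sh x) k"
    using tri_unrotate[OF assms(1)] by blast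
  moreover from z' have "isomorphic C z' z" using isomorphic_sh_iff assms by blast
  ultimately have "tri z (sh x) k"
    using tri_iso isomorphic_refl tri_ob by meson
  then obtain u where u: "isomorphic C (sh u) k" "u \<in> Ob C" "tri u z (sh x)"
    using tri_unrotate by blast
  obtain x' where x': "isomorphic C (sh x') (sh x)" "x' \<in> Ob C" "tri x' u z"
    using tri_unrotate[OF u(3)] by blast
  moreover from x' have "isomorphic C x' x" using isomorphic_sh_iff assms by blast
  ultimately have "tri x u z"
    using tri_iso isomorphic_refl tri_ob by meson
  then show ?thesis using u by blast
qed

text \<open>The octahedral axiom as associativity: with \<open>[c, d]\<close> for the middle vertex
  of a triangle with ends \<open>c\<close> and \<open>d\<close>, it turns \<open>[[x, z], w]\<close>
  into \<open>[x, [z, w]]\<close>.\<close>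

lemma tri_assoc_right:
  assumes "tri u y w" "tri x u z" shows "\<exists>v. tri x y v \<and> tri z v w"
proof -
  obtain f a a' where f: "tricat.dist C x u z f a a'" using assms(2) unfolding ex_triangle_def by blast
  obtain g b b' where g: "tricat.dist C u y w g b b'" using assms(1) unfolding ex_triangle_def by blast
  have t: "f \<in> Hom C x u" "g \<in> Hom C u y" using dist_typed f g by blast+
  obtain v c c' where v: "tricat.dist C x y v (g \<diamondop> f) c c'"
    using TR1_cone[OF cmp_closed[OF t]] by blast
  show ?thesis using TR4[OF t f g v] v unfolding ex_triangle_def by blast
qed

text \<open>The octahedron is applied to the rotated triangles, where it yields the wanted object
  shifted by one. The two desuspensions agree because the shift reflects isomorphism.\<close>

lemma tri_assoc_left:
  assumes "tri x y v" "tri z v w" shows "\<exists>u. tri x u z \<and> tri u y w"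
proof -
  obtain k where k: "tri y w k" "tri (sh x) k (sh z)"
    using tri_assoc_right[OF tri_rotate[OF assms(2)] tri_rotate[OF assms(1)]] by blast
  obtain u where u: "isomorphic C (sh u) k" "u \<in> Ob C" "tri x u z"
    using tri_unsh[OF k(2)] tri_ob assms by blast
  obtain u' where u': "isomorphic C (sh u') k" "u' \<in> Ob C" "tri u' y w"
    using tri_unrotate[OF k(1)] by blast
  have "isomorphic C u' u"
    using isomorphic_sh_iff u u' isomorphic_trans isomorphic_sym by blast
  then have "tri u y w" using tri_iso u'(3) isomorphic_refl tri_ob by blast
  then show ?thesis using u by blast
qed

lemma hom_zero_tri_left:
  assumes "tri x y z" "hom_zero x w" "hom_zero z w" "w \<in> Ob C" shows "hom_zero y w"
proof -
  obtain f g h where d: "tricat.dist C x y z f g h" using assms(1) unfolding ex_triangle_def by blast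
  have t: "f \<in> Hom C x y" "g \<in> Hom C y z" using dist_typed[OF d] by auto
  have "k = zerom C y w" if k: "k \<in> Hom C y w" for k
    using dist_extend[OF d k] hom_zeroD[OF assms(2) cmp_closed[OF t(1) k]] hom_zeroD[OF assms(3)]
      cmp_zero_left[OF assms(4) t(2)] by metis
  then show ?thesis using hom_zero_iff assms tri_ob by blast
qed

lemma hom_zero_tri_right:
  assumes "tri x y z" "hom_zero w x" "hom_zero w z" "w \<in> Ob C" shows "hom_zero w y"
proof -
  obtain f g h where d: "tricat.dist C x y z f g h" using assms(1) unfolding ex_triangle_def by blast
  have t: "f \<in> Hom C x y" "g \<in> Hom C y z" using dist_typed[OF d] by auto
  have "k = zerom C w y" if k: "k \<in> Hom C w y" for k
    using dist_lift[OF d k] hom_zeroD[OF assms(3) cmp_closed[OF k t(2)]] hom_zeroD[OF assms(2)]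
      cmp_zero_right[OF assms(4) t(1)] by metis
  then show ?thesis using hom_zero_iff assms tri_ob by blast
qed

lemma hom_zero_zero_object:
  assumes "zero_object C z" "x \<in> Ob C" shows "hom_zero x z" "hom_zero z x"
  using assms zero_object_hom unfolding hom_zero_def by blast+

text \<open>Consecutive maps of a rotated triangle compose to zero, so
  \<open>shM C i \<diamondop> e\<close> vanishes, and \<open>shM C r\<close> is a left inverse of
  \<open>shM C i\<close>.\<close>

lemma dist_split_mono:
  assumes d: "tricat.dist C h k c i g e" and r: "r \<in> Hom C k h" and ri: "r \<diamondop> i = idm C h"
  shows "e = zerom C c (sh h)"
proof -
  have t: "i \<in> Hom C h k" "g \<in> Hom C k c" "e \<in> Hom C c (sh h)" using dist_typed[OF d] by auto
  have ob: "h \<in> Ob C" "k \<in> Ob C" "c \<in> Ob C" using t hom_ob by blast+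
  have "neg (sh h) (sh k) (shM C i) \<diamondop> e = zerom C c (sh k)"
    using dist_cmp_zero[OF dist_rotate[OF dist_rotate[OF d]]] .
  then have "neg c (sh k) (shM C i \<diamondop> e) = neg c (sh k) (zerom C c (sh k))"
    using cmp_neg_left[OF t(3) sh_hom[OF t(1)]] neg_unique[OF zero_closed zero_closed zero_add[OF zero_closed]]
      ob sh_ob by metis
  then have ie: "shM C i \<diamondop> e = zerom C c (sh k)"
    using neg_inj[OF cmp_closed[OF t(3) sh_hom[OF t(1)]] zero_closed] ob sh_ob by blast
  have "e = (shM C r \<diamondop> shM C i) \<diamondop> e"
    using sh_cmp[OF t(1) r] ri sh_id[OF ob(1)] cmp_id_left[OF t(3)] by simp
  also have "\<dots> = shM C r \<diamondop> (shM C i \<diamondop> e)" using cmp_assoc[OF t(3) sh_hom[OF t(1)] sh_hom[OF r]] .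
  also have "\<dots> = zerom C c (sh h)" unfolding ie using cmp_zero_right[OF ob(3) sh_hom[OF r]] .
  finally show ?thesis .
qed

text \<open>By exactness a map killed by \<open>g\<close> factors through the third map, which is
  zero here.\<close>

lemma dist_epi:
  assumes d: "tricat.dist C x y z f g (zerom C z (sh x))"
    and k: "k \<in> Hom C z w" "k' \<in> Hom C z w" "k \<diamondop> g = k' \<diamondop> g"
  shows "k = k'"
proof -
  have t: "f \<in> Hom C x y" "g \<in> Hom C y z" using dist_typed[OF d] by auto
  have ob: "x \<in> Ob C" "z \<in> Ob C" "w \<in> Ob C" using t k hom_ob by blast+
  define \<delta> where "\<delta> = addm C k (neg z w k')"
  have \<delta>: "\<delta> \<in> Hom C z w" unfolding \<delta>_def using add_closed neg_closed k by blast
  have "\<delta> \<diamondop> g = zerom C y w"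
    unfolding \<delta>_def using cmp_add_left[OF t(2) k(1) neg_closed[OF k(2)]] cmp_neg_left[OF t(2) k(2)] k(3)
      add_neg[OF cmp_closed[OF t(2) k(2)]] by simp
  then obtain l where l: "l \<in> Hom C (sh x) w" "l \<diamondop> zerom C z (sh x) = \<delta>"
    using dist_extend[OF dist_rotate[OF d] \<delta>] by blast
  then have "\<delta> = zerom C z w" using cmp_zero_right[OF ob(2) l(1)] by simp
  then show ?thesis unfolding \<delta>_def using add_neg_eq[OF k(1,2)] by blast
qed

end

section \<open>Truncations of a slicing\<close>

context triangulated_category
begin

text \<open>Orthogonality replaces a condition on the phases of factors: closure under extensions
  and isomorphisms is immediate, at the price that Harder--Narasimhan filtrations must be brought
  back in \<open>hom_zero_above_below\<close>.\<close>

definition lperp :: "'a set \<Rightarrow> 'a set" where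
  "lperp B = {x \<in> Ob C. \<forall>y\<in>B. hom_zero x y}"

definition rperp :: "'a set \<Rightarrow> 'a set" where
  "rperp B = {y \<in> Ob C. \<forall>x\<in>B. hom_zero x y}"

lemma lperp_tri: "B \<subseteq> Ob C \<Longrightarrow> tri x y z \<Longrightarrow> x \<in> lperp B \<Longrightarrow> z \<in> lperp B \<Longrightarrow> y \<in> lperp B"
  unfolding lperp_def using hom_zero_tri_left tri_ob by blast

lemma rperp_tri: "B \<subseteq> Ob C \<Longrightarrow> tri x y z \<Longrightarrow> x \<in> rperp B \<Longrightarrow> z \<in> rperp B \<Longrightarrow> y \<in> rperp B"
  unfolding rperp_def using hom_zero_tri_right tri_ob by blast

lemma zero_lperp: "B \<subseteq> Ob C \<Longrightarrow> zero_object C z \<Longrightarrow> z \<in> lperp B"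
  unfolding lperp_def using hom_zero_zero_object(2) zero_object_ob by blast

lemma zero_rperp: "B \<subseteq> Ob C \<Longrightarrow> zero_object C z \<Longrightarrow> z \<in> rperp B"
  unfolding rperp_def using hom_zero_zero_object(1) zero_object_ob by blast

lemma lperp_iso: "B \<subseteq> Ob C \<Longrightarrow> isomorphic C x y \<Longrightarrow> x \<in> lperp B \<Longrightarrow> y \<in> lperp B"
  unfolding lperp_def using hom_zero_iso_left isomorphic_ob by blast

lemma rperp_iso: "B \<subseteq> Ob C \<Longrightarrow> isomorphic C x y \<Longrightarrow> x \<in> rperp B \<Longrightarrow> y \<in> rperp B"
  unfolding rperp_def using hom_zero_iso_right isomorphic_ob by blast

lemma extension_closure_mono:
  assumes "A \<subseteq> B" "x \<in> extension_closure C A" shows "x \<in> extension_closure C B"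
  using assms(2)
proof (induction rule: extension_closure.induct)
  case (base x)
  then show ?case using assms(1) extension_closure.base by (metis subsetD)
qed (use extension_closure.zero extension_closure.extension in metis)+

lemma extension_closure_subset:
  assumes "x \<in> extension_closure C A" "A \<subseteq> B" "\<And>z. zero_object C z \<Longrightarrow> z \<in> B"
    "\<And>x y z. tri x y z \<Longrightarrow> x \<in> B \<Longrightarrow> z \<in> B \<Longrightarrow> y \<in> B"
  shows "x \<in> B"
  using assms(1) by (induction rule: extension_closure.induct) (use assms(2-) in blast)+

text \<open>These are the functions that factor through the Grothendieck group, kept on objects so
  that no cosets are needed.\<close>

definition tri_additive :: "('a \<Rightarrow> complex) \<Rightarrow> bool" where
  "tri_additive \<zeta> \<longleftrightarrow> (\<forall>x y z. tri x y z \<longrightarrow> \<zeta> y = \<zeta> x + \<zeta> z)"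

lemma tri_additive_zero: "tri_additive \<zeta> \<Longrightarrow> zero_object C z \<Longrightarrow> \<zeta> z = 0"
  unfolding tri_additive_def using tri_id[OF zero_object_ob] by (metis add_cancel_left_left)

lemma filtration_ob: "filtration C n x a \<Longrightarrow> i \<le> n \<Longrightarrow> x i \<in> Ob C"
  unfolding filtration_def by (cases i) (auto dest!: tri_ob zero_object_ob Suc_le_lessD)

text \<open>Octahedra add the cones one at a time. Quantifying over all \<open>\<zeta>\<close>
  inside the existential ties the values of additive functions to the same cone \<open>w\<close>,
  before any central charge is fixed.\<close>

lemma filtration_segment:
  assumes "filtration C n x a" "k \<le> m" "m \<le> n"
  shows "\<exists>w. tri (x k) (x m) w \<and> w \<in> extension_closure C (a ` {k..<m}) \<and>
    (\<forall>\<zeta>. tri_additive \<zeta> \<longrightarrow> \<zeta> w = (\<Sum>i\<in>{k..<m}. \<zeta> (a i)))"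
  using assms(2,3)
proof (induction m rule: dec_induct)
  case base
  obtain z where z: "zero_object C z" using ex_zero_object by blast
  then show ?case
    using tri_id[OF filtration_ob[OF assms(1) base] z] tri_additive_zero extension_closure.zero
    by (intro exI[of _ z]) auto
next
  case (step m)
  then obtain w where w: "tri (x k) (x m) w" "w \<in> extension_closure C (a ` {k..<m})"
    "\<forall>\<zeta>. tri_additive \<zeta> \<longrightarrow> \<zeta> w = (\<Sum>i\<in>{k..<m}. \<zeta> (a i))" by auto
  have "tri (x m) (x (Suc m)) (a m)" using assms(1) step unfolding filtration_def by simp
  then obtain v where v: "tri (x k) (x (Suc m)) v" "tri w v (a m)"
    using tri_assoc_right w(1) by blast
  have "w \<in> extension_closure C (a ` {k..<Suc m})"
    using w(2) by (rule extension_closure_mono[rotated]) auto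
  moreover have "a m \<in> extension_closure C (a ` {k..<Suc m})"
    using step by (intro extension_closure.base) auto
  ultimately have "v \<in> extension_closure C (a ` {k..<Suc m})"
    using extension_closure.extension[OF _ _ v(2)] by simp
  moreover have "\<zeta> v = (\<Sum>i\<in>{k..<Suc m}. \<zeta> (a i))" if "tri_additive \<zeta>" for \<zeta>
    using that v(2) w(3) step unfolding tri_additive_def by (simp add: sum.atLeastLessThan_Suc)
  ultimately show ?case using v by blast
qed

end

section \<open>Truncation by phase\<close>

locale slicing = triangulated_category +
  fixes P :: "'a slicing"
  assumes slicing: "is_slicing C P"
begin

lemma P_ob: "x \<in> P \<phi> \<Longrightarrow> x \<in> Ob C"
  using slicing unfolding is_slicing_def additive_subcategory_def by blast

lemma P_sh_iff: "y \<in> P (\<phi> + 1) \<longleftrightarrow> (\<exists>x\<in>P \<phi>. isomorphic C (sh x) y)"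
  using slicing unfolding is_slicing_def by blast

lemma P_sh: "x \<in> P \<phi> \<Longrightarrow> sh x \<in> P (\<phi> + 1)"
  using P_sh_iff P_ob sh_ob isomorphic_refl by metis

lemma P_hom_zero: "\<psi> < \<phi> \<Longrightarrow> x \<in> P \<phi> \<Longrightarrow> y \<in> P \<psi> \<Longrightarrow> hom_zero x y"
  using slicing unfolding is_slicing_def hom_zero_def by blast

lemma HN_exists:
  assumes "y \<in> Ob C" shows "\<exists>n x a \<phi>. HN_filtration C P y n x a \<phi>"
proof (cases "zero_object C y")
  case True
  \<comment> \<open>Slicings provide filtrations of non-zero objects only; a zero object gets the
    empty one, whose factors and phases are never inspected.\<close>
  then have "HN_filtration C P y 0 (\<lambda>_. y) undefined undefined"
    unfolding HN_filtration_def filtration_def by simp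
  then show ?thesis by blast
qed (use assms slicing in \<open>unfold is_slicing_def, blast\<close>)

definition above :: "real \<Rightarrow> 'a set" where "above t = lperp (\<Union>\<phi>\<in>{..t}. P \<phi>)"

definition below :: "real \<Rightarrow> 'a set" where "below t = rperp (\<Union>\<phi>\<in>{t<..}. P \<phi>)"

lemma Union_P_ob: "(\<Union>\<phi>\<in>I. P \<phi>) \<subseteq> Ob C"
  using P_ob by blast

lemmas above_tri = lperp_tri[OF Union_P_ob, of _ _ _ "{..t}" for t, folded above_def]
lemmas below_tri = rperp_tri[OF Union_P_ob, of _ _ _ "{t<..}" for t, folded below_def]
lemmas zero_above = zero_lperp[OF Union_P_ob, of _ "{..t}" for t, folded above_def]
lemmas zero_below = zero_rperp[OF Union_P_ob, of _ "{t<..}" for t, folded below_def]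
lemmas above_iso = lperp_iso[OF Union_P_ob, of _ _ "{..t}" for t, folded above_def]
lemmas below_iso = rperp_iso[OF Union_P_ob, of _ _ "{t<..}" for t, folded below_def]

lemma above_ob: "x \<in> above t \<Longrightarrow> x \<in> Ob C"
  unfolding above_def lperp_def by blast

lemma below_ob: "x \<in> below t \<Longrightarrow> x \<in> Ob C"
  unfolding below_def rperp_def by blast

lemma above_mono: "x \<in> above s \<Longrightarrow> t \<le> s \<Longrightarrow> x \<in> above t"
  unfolding above_def lperp_def by fastforce

lemma below_mono: "x \<in> below s \<Longrightarrow> s \<le> t \<Longrightarrow> x \<in> below t"
  unfolding below_def rperp_def by fastforce

lemma P_above:
  assumes "t < \<phi>" "x \<in> P \<phi>" shows "x \<in> above t"
proof -
  have "hom_zero x y" if "y \<in> P \<psi>" "\<psi> \<le> t" for y \<psi>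
    using P_hom_zero[OF _ assms(2) that(1)] that(2) assms(1) by simp
  then show ?thesis unfolding above_def lperp_def using P_ob assms(2) by blast
qed

lemma P_below:
  assumes "\<phi> \<le> t" "x \<in> P \<phi>" shows "x \<in> below t"
proof -
  have "hom_zero y x" if "y \<in> P \<psi>" "t < \<psi>" for y \<psi>
    using P_hom_zero[OF _ that(1) assms(2)] that(2) assms(1) by simp
  then show ?thesis unfolding below_def rperp_def using P_ob assms(2) by blast
qed

lemma above_sh:
  assumes "x \<in> Ob C" shows "sh x \<in> above (t + 1) \<longleftrightarrow> x \<in> above t"
proof
  assume x: "sh x \<in> above (t + 1)"
  have "hom_zero x y" if "y \<in> P \<phi>" "\<phi> \<le> t" for y \<phi>
  proof -
    have "hom_zero (sh x) (sh y)"
      using x P_sh[OF that(1)] that(2) unfolding above_def lperp_def by fastforce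
    then show ?thesis using hom_zero_sh assms P_ob that by blast
  qed
  then show "x \<in> above t" unfolding above_def lperp_def using assms by blast
next
  assume x: "x \<in> above t"
  have "hom_zero (sh x) y" if "y \<in> P \<phi>" "\<phi> \<le> t + 1" for y \<phi>
  proof -
    have "y \<in> P ((\<phi> - 1) + 1)" using that by simp
    then obtain y' where y': "y' \<in> P (\<phi> - 1)" "isomorphic C (sh y') y" using P_sh_iff by blast
    have "hom_zero x y'" using x y'(1) that(2) unfolding above_def lperp_def by force
    then show ?thesis using hom_zero_iso_right[OF y'(2)] hom_zero_sh assms P_ob y' sh_ob by blast
  qed
  then show "sh x \<in> above (t + 1)" unfolding above_def lperp_def using assms sh_ob by blast
qed

lemma below_sh:
  assumes "x \<in> Ob C" shows "sh x \<in> below (t + 1) \<longleftrightarrow> x \<in> below t"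
proof
  assume x: "sh x \<in> below (t + 1)"
  have "hom_zero y x" if "y \<in> P \<phi>" "t < \<phi>" for y \<phi>
  proof -
    have "hom_zero (sh y) (sh x)"
      using x P_sh[OF that(1)] that(2) unfolding below_def rperp_def by fastforce
    then show ?thesis using hom_zero_sh assms P_ob that by blast
  qed
  then show "x \<in> below t" unfolding below_def rperp_def using assms by blast
next
  assume x: "x \<in> below t"
  have "hom_zero y (sh x)" if "y \<in> P \<phi>" "t + 1 < \<phi>" for y \<phi>
  proof -
    have "y \<in> P ((\<phi> - 1) + 1)" using that by simp
    then obtain y' where y': "y' \<in> P (\<phi> - 1)" "isomorphic C (sh y') y" using P_sh_iff by blast
    have "hom_zero y' x" using x y'(1) that(2) unfolding below_def rperp_def by force
    then show ?thesis using hom_zero_iso_left[OF y'(2)] hom_zero_sh assms P_ob y' sh_ob by blast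
  qed
  then show "sh x \<in> below (t + 1)" unfolding below_def rperp_def using assms sh_ob by blast
qed

text \<open>Phases decrease strictly, so those exceeding \<open>t\<close> occupy an initial
  segment.\<close>

lemma HN_split:
  assumes "HN_filtration C P y n x a \<phi>"
  shows "\<exists>k\<le>n. \<forall>i<n. i < k \<longleftrightarrow> t < \<phi> i"
proof -
  \<comment> \<open>The disjunct \<open>n \<le> k\<close> yields \<open>k = n\<close> when every
    phase exceeds \<open>t\<close>.\<close>
  define k where "k = (LEAST k. n \<le> k \<or> \<phi> k \<le> t)"
  have k: "n \<le> k \<or> \<phi> k \<le> t" "k \<le> n"
    unfolding k_def by (rule LeastI[of _ n], simp) (rule Least_le, simp)
  have "i < k \<longleftrightarrow> t < \<phi> i" if "i < n" for i
  proof
    assume "i < k" then show "t < \<phi> i" unfolding k_def using not_less_Least by fastforce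
  next
    assume "t < \<phi> i"
    show "i < k"
    proof (rule ccontr)
      assume "\<not> i < k"
      then have "\<phi> k \<le> t" using k that by auto
      moreover have "k = i \<or> \<phi> i < \<phi> k"
        using \<open>\<not> i < k\<close> that assms unfolding HN_filtration_def by (meson linorder_neqE_nat)
      ultimately show False using \<open>t < \<phi> i\<close> by auto
    qed
  qed
  then show ?thesis using k by blast
qed

lemma HN_segment:
  assumes "HN_filtration C P y n x a \<phi>" "k \<le> m" "m \<le> n" "\<And>i. k \<le> i \<Longrightarrow> i < m \<Longrightarrow> \<phi> i \<in> I"
  shows "\<exists>w. tri (x k) (x m) w \<and> w \<in> extension_closure C (\<Union>\<phi>\<in>I. P \<phi>) \<and>
    (\<forall>\<zeta>. tri_additive \<zeta> \<longrightarrow> \<zeta> w = (\<Sum>i\<in>{k..<m}. \<zeta> (a i)))"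
proof -
  have "a ` {k..<m} \<subseteq> (\<Union>\<phi>\<in>I. P \<phi>)"
  proof
    fix y assume "y \<in> a ` {k..<m}"
    then obtain i where i: "y = a i" "k \<le> i" "i < m" by auto
    then have "y \<in> P (\<phi> i)" using assms(1,3) unfolding HN_filtration_def by simp
    then show "y \<in> (\<Union>\<phi>\<in>I. P \<phi>)" using assms(4)[OF i(2,3)] by blast
  qed
  moreover have "filtration C n x a" using assms(1) unfolding HN_filtration_def by blast
  ultimately show ?thesis
    using filtration_segment[OF _ assms(2,3)] extension_closure_mono by metis
qed

lemma extension_closure_above:
  assumes "x \<in> extension_closure C (\<Union>\<phi>\<in>I. P \<phi>)" "I \<subseteq> {t<..}" shows "x \<in> above t"
  by (rule extension_closure_subset[OF assms(1)]) (use assms(2) P_above zero_above above_tri in blast)+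

lemma extension_closure_below:
  assumes "x \<in> extension_closure C (\<Union>\<phi>\<in>I. P \<phi>)" "I \<subseteq> {..t}" shows "x \<in> below t"
  by (rule extension_closure_subset[OF assms(1)]) (use assms(2) P_below zero_below below_tri in blast)+

text \<open>A map from \<open>w\<close> to \<open>v\<close> dies in the part of \<open>v\<close>
  with phases at most \<open>t\<close>, to which \<open>w\<close> is orthogonal, and hence lifts to
  the part with phases above \<open>t\<close>. That part maps to \<open>v\<close> by zero, because
  \<open>v\<close> lies in \<open>below t\<close>.\<close>

lemma hom_zero_above_below:
  assumes w: "w \<in> above t" and v: "v \<in> below t" shows "hom_zero w v"
proof -
  have ob: "w \<in> Ob C" "v \<in> Ob C" using assms above_ob below_ob by auto
  obtain n x a \<phi> where HN: "HN_filtration C P v n x a \<phi>" using HN_exists ob by blast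
  then have x: "zero_object C (x 0)" "x n = v" unfolding HN_filtration_def filtration_def by auto
  obtain k where k: "k \<le> n" "\<forall>i<n. i < k \<longleftrightarrow> t < \<phi> i" using HN_split[OF HN] by blast
  have split: "t < \<phi> i" if "i < k" for i using k that order.strict_trans2 by blast
  obtain u where u: "tri (x 0) (x k) u" "u \<in> extension_closure C (\<Union>\<phi>\<in>{t<..}. P \<phi>)"
    using HN_segment[OF HN, of 0 k "{t<..}"] k(1) split by auto
  obtain v' where v': "tri (x k) (x n) v'" "v' \<in> extension_closure C (\<Union>\<phi>\<in>{..t}. P \<phi>)"
    using HN_segment[OF HN, of k n "{..t}"] k by force
  have "\<And>y. y \<in> (\<Union>\<phi>\<in>{t<..}. P \<phi>) \<Longrightarrow> hom_zero y v"
    using v unfolding below_def rperp_def by blast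
  with u(2) have "hom_zero u v"
    by (induction rule: extension_closure.induct)
      (use hom_zero_zero_object(2)[OF _ ob(2)] hom_zero_tri_left[OF _ _ _ ob(2)] in blast)+
  then have uv: "hom_zero (x k) v"
    using hom_zero_tri_left[OF u(1)] hom_zero_zero_object(2)[OF x(1)] ob by blast
  have "\<And>y. y \<in> (\<Union>\<phi>\<in>{..t}. P \<phi>) \<Longrightarrow> hom_zero w y"
    using w unfolding above_def lperp_def by blast
  with v'(2) have wv: "hom_zero w v'"
    by (induction rule: extension_closure.induct)
      (use hom_zero_zero_object(1)[OF _ ob(1)] hom_zero_tri_right[OF _ _ _ ob(1)] in blast)+
  obtain f g h where d: "tricat.dist C (x k) v v' f g h"
    using v'(1) x(2) unfolding ex_triangle_def by blast
  have t: "f \<in> Hom C (x k) v" "g \<in> Hom C v v'" using dist_typed[OF d] by auto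
  have "e = zerom C w v" if e: "e \<in> Hom C w v" for e
  proof -
    obtain l where "l \<in> Hom C w (x k)" "f \<diamondop> l = e"
      using dist_lift[OF d e] hom_zeroD[OF wv cmp_closed[OF e t(2)]] by blast
    then show ?thesis using hom_zeroD[OF uv t(1)] cmp_zero_left[OF ob(2)] by metis
  qed
  then show ?thesis using hom_zero_iff ob by blast
qed

lemma above_below_zero: "x \<in> above t \<Longrightarrow> x \<in> below t \<Longrightarrow> zero_object C x"
  using hom_zero_above_below hom_zeroD id_closed zero_object_iff_id above_ob by blast

lemma truncation_exists:
  assumes "y \<in> Ob C" shows "\<exists>u v. u \<in> above t \<and> v \<in> below t \<and> tri u y v"
proof -
  obtain n x a \<phi> where HN: "HN_filtration C P y n x a \<phi>" using HN_exists assms by blast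
  then have x: "zero_object C (x 0)" "x n = y" unfolding HN_filtration_def filtration_def by auto
  obtain k where k: "k \<le> n" "\<forall>i<n. i < k \<longleftrightarrow> t < \<phi> i" using HN_split[OF HN] by blast
  have split: "t < \<phi> i" if "i < k" for i using k that order.strict_trans2 by blast
  obtain u where u: "tri (x 0) (x k) u" "u \<in> extension_closure C (\<Union>\<phi>\<in>{t<..}. P \<phi>)"
    using HN_segment[OF HN, of 0 k "{t<..}"] k(1) split by auto
  obtain v where v: "tri (x k) (x n) v" "v \<in> extension_closure C (\<Union>\<phi>\<in>{..t}. P \<phi>)"
    using HN_segment[OF HN, of k n "{..t}"] k by force
  have "x k \<in> above t" using above_tri[OF u(1)] zero_above[OF x(1)] extension_closure_above[OF u(2)] by blast
  then show ?thesis using v x extension_closure_below[OF v(2)] by blast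
qed

text \<open>Both maps of the retraction pass to the truncations by exactness. Their composite agrees
  with the identity only after composing with the truncation map; the difference factors through an
  object which orthogonality cuts off.\<close>

lemma truncation_retract:
  assumes "tri u y v" "u \<in> above t" "v \<in> below t"
    and "tri u' y' v'" "u' \<in> above t" "v' \<in> below t" and "retract y y'"
  shows "retract u u'" "retract v v'"
proof -
  obtain i r where i: "i \<in> Hom C y y'" and r: "r \<in> Hom C y' y" and ri: "r \<diamondop> i = idm C y"
    using assms(7) unfolding retract_def by blast
  obtain f g h where d: "tricat.dist C u y v f g h" using assms(1) unfolding ex_triangle_def by blast
  have f: "f \<in> Hom C u y" "g \<in> Hom C y v" "h \<in> Hom C v (sh u)" using dist_typed[OF d] by auto
  obtain f' g' h' where d': "tricat.dist C u' y' v' f' g' h'" using assms(4) unfolding ex_triangle_def by blast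
  have f': "f' \<in> Hom C u' y'" "g' \<in> Hom C y' v'" using dist_typed[OF d'] by auto
  have ob: "u \<in> Ob C" "v \<in> Ob C" "u' \<in> Ob C" "v' \<in> Ob C"
    using assms above_ob below_ob by blast+
  have z: "g' \<diamondop> (i \<diamondop> f) = zerom C u v'" "g \<diamondop> (r \<diamondop> f') = zerom C u' v"
    using hom_zeroD[OF hom_zero_above_below] assms(2,3,5,6) cmp_closed f f' i r by meson+
  show "retract u u'"
  proof -
    obtain i1 where i1: "i1 \<in> Hom C u u'" "f' \<diamondop> i1 = i \<diamondop> f"
      using dist_lift[OF d' cmp_closed[OF f(1) i] z(1)] by blast
    obtain r1 where r1: "r1 \<in> Hom C u' u" "f \<diamondop> r1 = r \<diamondop> f'"
      using dist_lift[OF d cmp_closed[OF f'(1) r] z(2)] by blast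
    define e where "e = r1 \<diamondop> i1"
    have e: "e \<in> Hom C u u" unfolding e_def using cmp_closed i1 r1 by blast
    have "f \<diamondop> e = (r \<diamondop> f') \<diamondop> i1" unfolding e_def using cmp_assoc[OF i1(1) r1(1) f(1)] r1(2) by simp
    also have "\<dots> = r \<diamondop> (i \<diamondop> f)" using cmp_assoc[OF i1(1) f'(1) r] i1(2) by simp
    also have "\<dots> = f" using cmp_assoc[OF f(1) i r] ri cmp_id_left[OF f(1)] by simp
    finally have fe: "f \<diamondop> e = f" .
    define \<delta> where "\<delta> = addm C e (neg u u (idm C u))"
    have id: "idm C u \<in> Hom C u u" using id_closed ob by blast
    have \<delta>: "\<delta> \<in> Hom C u u" unfolding \<delta>_def using add_closed e neg_closed id by blast
    have "f \<diamondop> \<delta> = zerom C u y"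
      unfolding \<delta>_def using cmp_add_right[OF e neg_closed[OF id] f(1)] cmp_neg_right[OF id f(1)]
        cmp_id_right[OF f(1)] fe add_neg[OF f(1)] by simp
    \<comment> \<open>\<open>w\<close> is \<open>v[-1]\<close>, hence still in
      \<open>below t\<close>, and maps from \<open>u\<close> to it vanish.\<close>
    moreover obtain w p v0 where w: "isomorphic C (sh w) v" "tricat.dist C w u y p f v0"
      using dist_unrotate[OF d] by blast
    ultimately obtain l where l: "l \<in> Hom C u w" "p \<diamondop> l = \<delta>"
      using dist_lift[OF w(2) \<delta>] by blast
    have p: "p \<in> Hom C w u" using dist_typed[OF w(2)] by blast
    have "sh w \<in> below t" using below_iso[OF isomorphic_sym[OF w(1)] assms(3)] .
    then have "w \<in> below t" using below_sh[of w t] below_mono[of "sh w" t "t + 1"] p hom_ob by simp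
    then have "l = zerom C u w" using hom_zero_above_below assms(2) hom_zeroD l by blast
    then have "\<delta> = zerom C u u" using l(2) cmp_zero_right[OF ob(1) p] by simp
    then have "e = idm C u" unfolding \<delta>_def using add_neg_eq[OF e id] by blast
    then show ?thesis unfolding retract_def e_def using i1 r1 by blast
  qed
  show "retract v v'"
  proof -
    have z': "(g' \<diamondop> i) \<diamondop> f = zerom C u v'" "(g \<diamondop> r) \<diamondop> f' = zerom C u' v"
      using z cmp_assoc[OF f(1) i f'(2)] cmp_assoc[OF f'(1) r f(2)] by simp_all
    obtain i1 where i1: "i1 \<in> Hom C v v'" "i1 \<diamondop> g = g' \<diamondop> i"
      using dist_extend[OF d cmp_closed[OF i f'(2)] z'(1)] by blast
    obtain r1 where r1: "r1 \<in> Hom C v' v" "r1 \<diamondop> g' = g \<diamondop> r"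
      using dist_extend[OF d' cmp_closed[OF r f(2)] z'(2)] by blast
    define e where "e = r1 \<diamondop> i1"
    have e: "e \<in> Hom C v v" unfolding e_def using cmp_closed i1 r1 by blast
    have "e \<diamondop> g = r1 \<diamondop> (g' \<diamondop> i)" unfolding e_def using cmp_assoc[OF f(2) i1(1) r1(1)] i1(2) by simp
    also have "\<dots> = (g \<diamondop> r) \<diamondop> i" using cmp_assoc[OF i f'(2) r1(1)] r1(2) by simp
    also have "\<dots> = g" using cmp_assoc[OF i r f(2)] ri cmp_id_right[OF f(2)] by simp
    finally have eg: "e \<diamondop> g = g" .
    define \<delta> where "\<delta> = addm C e (neg v v (idm C v))"
    have id: "idm C v \<in> Hom C v v" using id_closed ob by blast
    have \<delta>: "\<delta> \<in> Hom C v v" unfolding \<delta>_def using add_closed e neg_closed id by blast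
    have "\<delta> \<diamondop> g = zerom C y v"
      unfolding \<delta>_def using cmp_add_left[OF f(2) e neg_closed[OF id]] cmp_neg_left[OF f(2) id]
        cmp_id_left[OF f(2)] eg add_neg[OF f(2)] by simp
    then obtain l where l: "l \<in> Hom C (sh u) v" "l \<diamondop> h = \<delta>"
      using dist_extend[OF dist_rotate[OF d] \<delta>] by blast
    \<comment> \<open>Dually, \<open>u[1]\<close> stays in \<open>above t\<close>.\<close>
    have "sh u \<in> above t" using above_sh[OF ob(1), of t] above_mono[of "sh u" "t + 1" t] assms(2) by simp
    then have "l = zerom C (sh u) v" using hom_zero_above_below assms(3) hom_zeroD l by blast
    then have "\<delta> = zerom C v v" using l(2) cmp_zero_left[OF ob(2) f(3)] by simp
    then have "e = idm C v" unfolding \<delta>_def using add_neg_eq[OF e id] by blast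
    then show ?thesis unfolding retract_def e_def using i1 r1 by blast
  qed
qed

lemma above_sh_mono: "x \<in> above t \<Longrightarrow> sh x \<in> above t"
  using above_sh[of x t] above_mono[of "sh x" "t + 1" t] above_ob by simp

lemma below_unsh_mono: "x \<in> Ob C \<Longrightarrow> sh x \<in> below t \<Longrightarrow> x \<in> below t"
  using below_sh[of x t] below_mono[of "sh x" t "t + 1"] by simp

lemma above_cone: "tri x y z \<Longrightarrow> x \<in> above t \<Longrightarrow> y \<in> above t \<Longrightarrow> z \<in> above t"
  using above_tri[OF tri_rotate] above_sh_mono by blast

text \<open>\<open>x\<close> is an extension of \<open>y\<close> by \<open>z[-1]\<close>, and
  \<open>below t\<close> is stable under desuspension.\<close>

lemma below_fibre:
  assumes "tri x y z" "y \<in> below t" "z \<in> below t" shows "x \<in> below t"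
proof -
  obtain w where w: "isomorphic C (sh w) z" "w \<in> Ob C" "tri w x y" using tri_unrotate[OF assms(1)] by blast
  have "w \<in> below t" using below_unsh_mono[OF w(2)] below_iso[OF isomorphic_sym[OF w(1)] assms(3)] by blast
  then show ?thesis using below_tri[OF w(3) _ assms(2)] by blast
qed

end

section \<open>The mass as an integral\<close>

text \<open>The denominator is that of integrating by parts twice. At both ends only the cosine term
  of the antiderivative survives, and its opposite signs there give the factor
  \<open>1 + 1 / q\<close>.\<close>

lemma has_integral_powr_sin:
  fixes q p :: real
  assumes "q > 0"
  shows "((\<lambda>t. if t \<in> {p - 1..p} then q powr t * sin (pi * (p - t)) else 0) has_integral
    (pi * (1 + 1 / q) / ((ln q)\<^sup>2 + pi\<^sup>2) * q powr p)) UNIV"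
proof -
  define d where "d = (ln q)\<^sup>2 + pi\<^sup>2"
  have d: "d > 0" unfolding d_def by (intro add_nonneg_pos) auto
  define F where "F t = q powr t * (ln q * sin (pi * (p - t)) + pi * cos (pi * (p - t))) / d" for t
  have "(F has_real_derivative q powr t * sin (pi * (p - t))) (at t)" for t
  proof -
    have "(F has_real_derivative (q powr t * ln q * (ln q * sin (pi * (p - t)) + pi * cos (pi * (p - t))) +
        q powr t * (ln q * (cos (pi * (p - t)) * - pi) + pi * (- sin (pi * (p - t)) * - pi))) / d) (at t)"
      unfolding F_def
      by (intro DERIV_cdivide) (use assms in \<open>auto intro!: derivative_eq_intros simp: algebra_simps\<close>)
    moreover have "(q powr t * ln q * (ln q * sin (pi * (p - t)) + pi * cos (pi * (p - t))) +
        q powr t * (ln q * (cos (pi * (p - t)) * - pi) + pi * (- sin (pi * (p - t)) * - pi))) =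
        q powr t * sin (pi * (p - t)) * d"
      unfolding d_def by (simp add: algebra_simps power2_eq_square)
    ultimately show ?thesis using d by simp
  qed
  then have "((\<lambda>t. q powr t * sin (pi * (p - t))) has_integral (F p - F (p - 1))) {p - 1..p}"
    by (intro fundamental_theorem_of_calculus)
      (auto simp: has_real_derivative_iff_has_vector_derivative[symmetric] intro: DERIV_subset)
  moreover have "F p - F (p - 1) = pi * (1 + 1 / q) / d * q powr p"
    unfolding F_def using assms d by (simp add: powr_diff field_simps)
  ultimately show ?thesis
    unfolding has_integral_restrict_UNIV d_def by simp
qed

section \<open>Central charges on objects: heights and cohomology\<close>

locale slicing_charge = slicing +
  fixes \<zeta> :: "'a \<Rightarrow> complex"
  assumes charge_additive: "tri_additive \<zeta>"
    and charge_P: "x \<in> P \<phi> \<Longrightarrow> \<not> zero_object C x \<Longrightarrow>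
      \<exists>m>0. \<zeta> x = complex_of_real m * cis (pi * \<phi>)"
begin

lemma charge_tri: "tri x y z \<Longrightarrow> \<zeta> y = \<zeta> x + \<zeta> z"
  using charge_additive unfolding tri_additive_def by blast

lemmas charge_zero = tri_additive_zero[OF charge_additive]

definition height :: "real \<Rightarrow> 'a \<Rightarrow> real" where
  "height t x = Im (cis (- (pi * t)) * \<zeta> x)"

lemma height_tri: "tri x y z \<Longrightarrow> height t y = height t x + height t z"
  unfolding height_def by (simp add: charge_tri algebra_simps)

lemma height_P:
  assumes "x \<in> P \<phi>" "\<not> zero_object C x"
  shows "height t x = cmod (\<zeta> x) * sin (pi * (\<phi> - t))"
proof -
  obtain m where m: "m > 0" "\<zeta> x = complex_of_real m * cis (pi * \<phi>)" using charge_P assms by blast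
  have "cis (- (pi * t)) * \<zeta> x = complex_of_real m * (cis (- (pi * t)) * cis (pi * \<phi>))"
    using m(2) by simp
  also have "\<dots> = complex_of_real m * cis (pi * (\<phi> - t))"
    by (simp add: cis_mult algebra_simps)
  finally have "height t x = m * sin (pi * (\<phi> - t))" unfolding height_def by simp
  moreover have "cmod (\<zeta> x) = m" using m by (simp add: norm_mult)
  ultimately show ?thesis by simp
qed

text \<open>\<open>above t\<close>, \<open>below t\<close> and \<open>heart t\<close> are \<open>P(>t)\<close>, \<open>P(\<le>t)\<close> and \<open>P(t, t + 1]\<close>.\<close>

definition heart :: "real \<Rightarrow> 'a set" where "heart t = above t \<inter> below (t + 1)"

text \<open>The pieces of \<open>y\<close>, from sub to quotient, are \<open>a\<close>,
  \<open>h\<close> and \<open>f\<close>. A relation suffices because only the height of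
  \<open>h\<close> is used, and this turns out not to depend on the choices.\<close>

definition has_cohomology :: "real \<Rightarrow> 'a \<Rightarrow> 'a \<Rightarrow> bool" where
  "has_cohomology t y h \<longleftrightarrow> h \<in> heart t \<and>
     (\<exists>u a f. a \<in> above (t + 1) \<and> f \<in> below t \<and> tri a u h \<and> tri u y f)"

text \<open>The filtration is cut where the phases pass \<open>t + 1\<close> and \<open>t\<close>;
  the middle cone is \<open>h\<close>.\<close>

lemma HN_has_cohomology:
  assumes HN: "HN_filtration C P y n x a \<phi>"
  shows "\<exists>h. has_cohomology t y h \<and> \<zeta> h = (\<Sum>i | i < n \<and> t < \<phi> i \<and> \<phi> i \<le> t + 1. \<zeta> (a i))"
proof -
  have x: "zero_object C (x 0)" "x n = y" using HN unfolding HN_filtration_def filtration_def by auto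
  obtain k where k: "k \<le> n" "\<And>i. i < n \<Longrightarrow> i < k \<longleftrightarrow> t + 1 < \<phi> i" using HN_split[OF HN] by blast
  obtain m where m: "m \<le> n" "\<And>i. i < n \<Longrightarrow> i < m \<longleftrightarrow> t < \<phi> i" using HN_split[OF HN] by blast
  have km: "k \<le> m"
  proof (rule ccontr)
    assume "\<not> k \<le> m"
    then have "m < k" "m < n" using k(1) by auto
    then show False using k(2)[of m] m(2)[of m] by simp
  qed
  have 1: "\<phi> i \<in> {t + 1<..}" if "i < k" for i using k that order.strict_trans2 by auto
  have 2: "\<phi> i \<in> {t<..t + 1}" if "k \<le> i" "i < m" for i
    using k(2)[of i] m(2)[of i] that m(1) by auto
  have 3: "\<phi> i \<in> {..t}" if "m \<le> i" "i < n" for i using m(2)[of i] that by auto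
  obtain w where w: "tri (x 0) (x k) w" "w \<in> extension_closure C (\<Union>\<phi>\<in>{t + 1<..}. P \<phi>)"
    using HN_segment[OF HN le0 k(1), of "{t + 1<..}"] 1 by blast
  obtain h where h: "tri (x k) (x m) h" "h \<in> extension_closure C (\<Union>\<phi>\<in>{t<..t + 1}. P \<phi>)"
      "\<zeta> h = (\<Sum>i\<in>{k..<m}. \<zeta> (a i))"
    using HN_segment[OF HN km m(1), of "{t<..t + 1}"] 2 charge_additive by blast
  obtain f where f: "tri (x m) (x n) f" "f \<in> extension_closure C (\<Union>\<phi>\<in>{..t}. P \<phi>)"
    using HN_segment[OF HN m(1) order_refl, of "{..t}"] 3 by blast
  have "x k \<in> above (t + 1)"
    using above_tri[OF w(1) zero_above[OF x(1)] extension_closure_above[OF w(2)]] by simp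
  moreover have "h \<in> above t" by (rule extension_closure_above[OF h(2)]) auto
  moreover have "h \<in> below (t + 1)" by (rule extension_closure_below[OF h(2)]) auto
  moreover have "f \<in> below t" by (rule extension_closure_below[OF f(2)]) auto
  ultimately have "has_cohomology t y h"
    unfolding has_cohomology_def heart_def using h(1) f(1) x(2) by blast
  moreover have "i \<in> {k..<m} \<longleftrightarrow> i < n \<and> t < \<phi> i \<and> \<phi> i \<le> t + 1" for i
    using k(2)[of i] m(2)[of i] m(1) by auto
  then have "{k..<m} = {i. i < n \<and> t < \<phi> i \<and> \<phi> i \<le> t + 1}" by blast
  ultimately show ?thesis using h(3) by auto
qed

lemma sum_height_HN:
  assumes HN: "HN_filtration C P y n x a \<phi>"
    and h: "\<zeta> h = (\<Sum>i | i < n \<and> t < \<phi> i \<and> \<phi> i \<le> t + 1. \<zeta> (a i))"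
  shows "height t h = (\<Sum>i | i < n \<and> t < \<phi> i \<and> \<phi> i \<le> t + 1. cmod (\<zeta> (a i)) * sin (pi * (\<phi> i - t)))"
proof -
  have "height t h = (\<Sum>i | i < n \<and> t < \<phi> i \<and> \<phi> i \<le> t + 1. height t (a i))"
    unfolding height_def h by (simp add: sum_distrib_left)
  also have "\<dots> = (\<Sum>i | i < n \<and> t < \<phi> i \<and> \<phi> i \<le> t + 1. cmod (\<zeta> (a i)) * sin (pi * (\<phi> i - t)))"
    by (rule sum.cong[OF refl]) (use HN height_P in \<open>auto simp: HN_filtration_def\<close>)
  finally show ?thesis .
qed

text \<open>The heart is defined by orthogonality, so the phases of \<open>h\<close> must first be
  located: the outer pieces \<open>b\<close> and \<open>f\<close> of its filtration vanish, and the
  remaining phases are those at which the sine is non-negative.\<close>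

lemma height_nonneg:
  assumes "h \<in> heart t" shows "0 \<le> height t h"
proof -
  have h: "h \<in> above t" "h \<in> below (t + 1)" using assms unfolding heart_def by auto
  obtain n x a \<phi> where HN: "HN_filtration C P h n x a \<phi>" using HN_exists above_ob h by blast
  obtain g where g: "has_cohomology t h g"
      "\<zeta> g = (\<Sum>i | i < n \<and> t < \<phi> i \<and> \<phi> i \<le> t + 1. \<zeta> (a i))"
    using HN_has_cohomology[OF HN] by blast
  obtain u b f where *: "b \<in> above (t + 1)" "f \<in> below t" "tri b u g" "tri u h f" "g \<in> heart t"
    using g(1) unfolding has_cohomology_def by blast
  have "u \<in> above t"
    using above_tri[OF *(3)] above_mono[OF *(1)] *(5) unfolding heart_def by simp
  then have "f \<in> above t" using above_cone[OF *(4)] h(1) by blast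
  then have f: "zero_object C f" using above_below_zero *(2) by blast
  have "u \<in> below (t + 1)" using below_fibre[OF *(4) h(2)] zero_below[OF f] by blast
  then have "b \<in> below (t + 1)" using below_fibre[OF *(3)] *(5) unfolding heart_def by blast
  then have "zero_object C b" using above_below_zero *(1) by blast
  then have "\<zeta> h = \<zeta> g" using charge_zero f charge_tri[OF *(3)] charge_tri[OF *(4)] by simp
  then have "height t h = height t g" unfolding height_def by simp
  also have "\<dots> \<ge> 0"
    unfolding sum_height_HN[OF HN g(2)]
  proof (rule sum_nonneg)
    fix i assume "i \<in> {i. i < n \<and> t < \<phi> i \<and> \<phi> i \<le> t + 1}"
    then have "0 \<le> pi * (\<phi> i - t)" "pi * (\<phi> i - t) \<le> pi" by auto
    then show "0 \<le> cmod (\<zeta> (a i)) * sin (pi * (\<phi> i - t))" using sin_ge_zero by simp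
  qed
  finally show ?thesis .
qed

text \<open>The cone of a split monomorphism in the heart stays in the heart: as its connecting map
  is zero, maps into it from phases above \<open>t + 1\<close> lift to \<open>k\<close>. Its height
  is the difference of the two.\<close>

lemma height_retract:
  assumes "h \<in> heart t" "k \<in> heart t" "retract h k" shows "height t h \<le> height t k"
proof -
  obtain i r where i: "i \<in> Hom C h k" and r: "r \<in> Hom C k h" and ri: "r \<diamondop> i = idm C h"
    using assms(3) unfolding retract_def by blast
  obtain c g e where d: "tricat.dist C h k c i g e" using TR1_cone[OF i] by blast
  have t: "g \<in> Hom C k c" "e \<in> Hom C c (sh h)" using dist_typed[OF d] by auto
  have tri: "tri h k c" using d unfolding ex_triangle_def by blast
  have ob: "h \<in> Ob C" "k \<in> Ob C" "c \<in> Ob C" using tri_ob[OF tri] by auto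
  have hk: "h \<in> above t" "k \<in> above t" "k \<in> below (t + 1)" using assms unfolding heart_def by auto
  have c1: "c \<in> above t" using above_cone[OF tri] hk by blast
  have e0: "e = zerom C c (sh h)" using dist_split_mono[OF d r ri] .
  have "hom_zero w c" if w: "w \<in> P \<phi>" "t + 1 < \<phi>" for w \<phi>
  proof -
    have "m = zerom C w c" if m: "m \<in> Hom C w c" for m
    proof -
      have "e \<diamondop> m = zerom C w (sh h)" unfolding e0 using cmp_zero_left[OF sh_ob[OF ob(1)] m] .
      then obtain l where l: "l \<in> Hom C w k" "g \<diamondop> l = m" using dist_lift[OF dist_rotate[OF d] m] by blast
      have "l = zerom C w k"
        using hom_zeroD[OF hom_zero_above_below[OF P_above[OF w(2,1)] hk(3)] l(1)] .
      then show ?thesis using l(2) cmp_zero_right[OF P_ob[OF w(1)] t(1)] by simp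
    qed
    then show ?thesis using hom_zero_iff P_ob w(1) ob(3) by blast
  qed
  then have "c \<in> below (t + 1)" unfolding below_def rperp_def using ob(3) by blast
  then have "0 \<le> height t c" using height_nonneg c1 unfolding heart_def by blast
  then show ?thesis using height_tri[OF tri] by simp
qed

text \<open>Cohomology arises by truncating at \<open>t\<close> and then at \<open>t + 1\<close>,
  and retracts survive each truncation.\<close>

lemma has_cohomology_retract:
  assumes "has_cohomology t y h" "has_cohomology t y' h'" "retract y y'"
  shows "height t h \<le> height t h'"
proof -
  obtain u a f where *: "a \<in> above (t + 1)" "f \<in> below t" "tri a u h" "tri u y f" "h \<in> heart t"
    using assms(1) unfolding has_cohomology_def by blast
  obtain u' a' f' where **: "a' \<in> above (t + 1)" "f' \<in> below t" "tri a' u' h'" "tri u' y' f'" "h' \<in> heart t"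
    using assms(2) unfolding has_cohomology_def by blast
  have "u \<in> above t"
    using above_tri[OF *(3)] above_mono[OF *(1)] *(5) unfolding heart_def by simp
  moreover have "u' \<in> above t"
    using above_tri[OF **(3)] above_mono[OF **(1)] **(5) unfolding heart_def by simp
  ultimately have "retract u u'"
    using truncation_retract(1)[OF *(4) _ *(2) **(4) _ **(2) assms(3)] by blast
  then have "retract h h'"
    using truncation_retract(2)[OF *(3,1) _ **(3,1)] *(5) **(5) unfolding heart_def by blast
  then show ?thesis using height_retract *(5) **(5) by blast
qed

text \<open>The cone of \<open>u -> y -> a\<close> is an extension of \<open>sh f\<close> by
  \<open>v\<close>. It lies on both sides of \<open>t + 1\<close>, so it is zero and
  \<open>u\<close> inherits the position of \<open>a\<close>.\<close>

lemma swap_below_above: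
  assumes "tri f y a" "f \<in> below t" "a \<in> above (t + 1)"
  shows "\<exists>u v. tri u y v \<and> u \<in> above (t + 1) \<and> v \<in> below t"
proof -
  obtain u v where uv: "u \<in> above t" "v \<in> below t" "tri u y v"
    using truncation_exists tri_ob[OF assms(1)] by blast
  obtain c where c: "tri u a c" "tri v c (sh f)"
    using tri_assoc_right[OF tri_rotate[OF assms(1)] uv(3)] by blast
  have shf: "sh f \<in> below (t + 1)" using below_sh below_ob assms(2) by blast
  have "c \<in> below (t + 1)" using below_tri[OF c(2) _ shf] below_mono[OF uv(2)] by simp
  moreover have "c \<in> above (t + 1)"
    using above_tri[OF tri_rotate[OF c(1)] assms(3)] above_sh above_ob uv(1) by blast
  ultimately have "zero_object C c" using above_below_zero by blast
  then obtain w where w: "tri w u a" "zero_object C w"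
    using tri_unrotate[OF c(1)] zero_object_sh isomorphic_sym zero_object_iso by metis
  then have "u \<in> above (t + 1)" using above_tri[OF w(1) zero_above[OF w(2)] assms(3)] by blast
  then show ?thesis using uv by blast
qed

text \<open>Here the cone \<open>c\<close> of \<open>u -> y -> h\<close> need not vanish but lies in
  the heart: \<open>u -> h -> c\<close> is a short exact sequence there, so the height drops by that
  of \<open>c\<close>.\<close>

lemma swap_below_heart:
  assumes "tri f y h" "f \<in> below t" "h \<in> heart t"
  shows "\<exists>u v. tri u y v \<and> u \<in> heart t \<and> v \<in> below t \<and> height t u \<le> height t h"
proof -
  have h: "h \<in> above t" "h \<in> below (t + 1)" using assms(3) unfolding heart_def by auto
  obtain u v where uv: "u \<in> above t" "v \<in> below t" "tri u y v"
    using truncation_exists tri_ob[OF assms(1)] by blast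
  obtain c where c: "tri u h c" "tri v c (sh f)"
    using tri_assoc_right[OF tri_rotate[OF assms(1)] uv(3)] by blast
  have shf: "sh f \<in> below (t + 1)" using below_sh below_ob assms(2) by blast
  have c1: "c \<in> below (t + 1)" using below_tri[OF c(2) _ shf] below_mono[OF uv(2)] by simp
  have c2: "c \<in> above t" using above_cone[OF c(1) uv(1) h(1)] .
  have "u \<in> below (t + 1)" using below_fibre[OF c(1) h(2) c1] .
  moreover have "0 \<le> height t c" using height_nonneg c1 c2 unfolding heart_def by blast
  ultimately show ?thesis using uv height_tri[OF c(1)] unfolding heart_def by fastforce
qed

text \<open>Dual to the previous swap: with \<open>b\<close> a desuspension of \<open>a\<close>, the
  fibre \<open>c\<close> of \<open>h -> v\<close> is an extension of \<open>u\<close> by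
  \<open>b\<close> and lies in the heart.\<close>

lemma swap_heart_above:
  assumes "tri h y a" "h \<in> heart t" "a \<in> above (t + 1)"
  shows "\<exists>u v. tri u y v \<and> u \<in> above (t + 1) \<and> v \<in> heart t \<and> height t v \<le> height t h"
proof -
  have h: "h \<in> above t" "h \<in> below (t + 1)" using assms(2) unfolding heart_def by auto
  obtain u v where uv: "u \<in> above (t + 1)" "v \<in> below (t + 1)" "tri u y v"
    using truncation_exists tri_ob[OF assms(1)] by blast
  obtain b where b: "isomorphic C (sh b) a" "b \<in> Ob C" "tri b h y" using tri_unrotate[OF assms(1)] by blast
  have b': "b \<in> above t"
    using above_sh[OF b(2)] above_iso[OF isomorphic_sym[OF b(1)] assms(3)] by blast
  obtain c where c: "tri b c u" "tri c h v" using tri_assoc_left[OF b(3) uv(3)] by blast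
  have c1: "c \<in> above t" using above_tri[OF c(1) b'] above_mono[OF uv(1)] by simp
  have c2: "c \<in> below (t + 1)" using below_fibre[OF c(2) h(2) uv(2)] .
  have "v \<in> above t" using above_cone[OF c(2) c1 h(1)] .
  moreover have "0 \<le> height t c" using height_nonneg c1 c2 unfolding heart_def by blast
  ultimately show ?thesis using uv height_tri[OF c(2)] unfolding heart_def by fastforce
qed

text \<open>With \<open>[c, d]\<close> for an extension of \<open>d\<close> by \<open>c\<close>, \<open>y\<close> is \<open>[a, h, f, a', h', f']\<close>. The three swaps sort
  these factors into the order above, heart, below without increasing the heights.\<close>

lemma has_cohomology_tri:
  assumes "has_cohomology t x h" "has_cohomology t z h'" "tri x y z"
  shows "\<exists>k. has_cohomology t y k \<and> height t k \<le> height t h + height t h'"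
proof -
  obtain u a f where u: "a \<in> above (t + 1)" "f \<in> below t" "tri a u h" "tri u x f" "h \<in> heart t"
    using assms(1) unfolding has_cohomology_def by blast
  obtain u' a' f' where u': "a' \<in> above (t + 1)" "f' \<in> below t" "tri a' u' h'" "tri u' z f'" "h' \<in> heart t"
    using assms(2) unfolding has_cohomology_def by blast
  \<comment> \<open>Regrouping makes the unsorted neighbours \<open>f\<close> and \<open>a'\<close>
    adjacent, as \<open>s\<close>.\<close>
  obtain v where v: "tri u y v" "tri f v z" using tri_assoc_right[OF assms(3) u(4)] by blast
  obtain w where w: "tri f w u'" "tri w v f'" using tri_assoc_left[OF v(2) u'(4)] by blast
  obtain s where s: "tri f s a'" "tri s w h'" using tri_assoc_left[OF w(1) u'(3)] by blast
  obtain a2 f2 where 2: "tri a2 s f2" "a2 \<in> above (t + 1)" "f2 \<in> below t"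
    using swap_below_above[OF s(1) u(2) u'(1)] by blast
  obtain r where r: "tri a2 w r" "tri f2 r h'" using tri_assoc_right[OF s(2) 2(1)] by blast
  obtain h2 f3 where 3: "tri h2 r f3" "h2 \<in> heart t" "f3 \<in> below t" "height t h2 \<le> height t h'"
    using swap_below_heart[OF r(2) 2(3) u'(5)] by blast
  obtain q where q: "tri a2 q h2" "tri q w f3" using tri_assoc_left[OF r(1) 3(1)] by blast
  obtain f4 where f4: "tri q v f4" "tri f3 f4 f'" using tri_assoc_right[OF w(2) q(2)] by blast
  obtain p where p: "tri u p q" "tri p y f4" using tri_assoc_left[OF v(1) f4(1)] by blast
  \<comment> \<open>It remains to move \<open>a2\<close> to the left of \<open>h\<close>; they
    become adjacent as \<open>j\<close>.\<close>
  obtain b where b: "tri a p b" "tri h b q" using tri_assoc_right[OF p(1) u(3)] by blast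
  obtain j where j: "tri h j a2" "tri j b h2" using tri_assoc_left[OF b(2) q(1)] by blast
  obtain a3 h3 where 5: "tri a3 j h3" "a3 \<in> above (t + 1)" "h3 \<in> heart t" "height t h3 \<le> height t h"
    using swap_heart_above[OF j(1) u(5) 2(2)] by blast
  \<comment> \<open>The sorted groups are \<open>a4 = [a, a3]\<close>, \<open>h4 = [h3, h2]\<close>
    and \<open>f4 = [f3, f']\<close>.\<close>
  obtain h4 where h4: "tri a3 b h4" "tri h3 h4 h2" using tri_assoc_right[OF j(2) 5(1)] by blast
  obtain a4 where a4: "tri a a4 a3" "tri a4 p h4" using tri_assoc_left[OF b(1) h4(1)] by blast
  have "f4 \<in> below t" using below_tri[OF f4(2) 3(3) u'(2)] .
  moreover have "a4 \<in> above (t + 1)" using above_tri[OF a4(1) u(1) 5(2)] .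
  moreover have "h4 \<in> heart t"
    using above_tri[OF h4(2)] below_tri[OF h4(2)] 5(3) 3(2) unfolding heart_def by blast
  ultimately have "has_cohomology t y h4"
    unfolding has_cohomology_def using a4(2) p(2) by blast
  moreover have "height t h4 \<le> height t h + height t h'"
    using height_tri[OF h4(2)] 3(4) 5(4) by simp
  ultimately show ?thesis by blast
qed

definition cohomology_height :: "'a \<Rightarrow> real \<Rightarrow> real" where
  "cohomology_height y t = (THE r. \<exists>h. has_cohomology t y h \<and> r = height t h)"

text \<open>An object is a retract of itself, so the retract inequality in both directions removes
  the dependence on \<open>h\<close>.\<close>

lemma cohomology_height_eq:
  assumes "has_cohomology t y h" shows "cohomology_height y t = height t h"
proof -
  have "y \<in> Ob C" using assms tri_ob unfolding has_cohomology_def by blast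
  then have "height t h' = height t h" if "has_cohomology t y h'" for h'
    using has_cohomology_retract[OF assms that retract_refl] has_cohomology_retract[OF that assms retract_refl]
    by simp
  then show ?thesis unfolding cohomology_height_def using assms by (intro the_equality) blast+
qed

lemma has_cohomology_exists: "y \<in> Ob C \<Longrightarrow> \<exists>h. has_cohomology t y h"
  using HN_exists HN_has_cohomology by meson

lemma cohomology_height_HN:
  assumes "HN_filtration C P y n x a \<phi>"
  shows "cohomology_height y t =
    (\<Sum>i | i < n \<and> t < \<phi> i \<and> \<phi> i \<le> t + 1. cmod (\<zeta> (a i)) * sin (pi * (\<phi> i - t)))"
proof -
  obtain h where "has_cohomology t y h" "\<zeta> h = (\<Sum>i | i < n \<and> t < \<phi> i \<and> \<phi> i \<le> t + 1. \<zeta> (a i))"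
    using HN_has_cohomology[OF assms] by blast
  then show ?thesis using sum_height_HN[OF assms] cohomology_height_eq by simp
qed

lemma cohomology_height_tri:
  assumes "tri x y z" shows "cohomology_height y t \<le> cohomology_height x t + cohomology_height z t"
  using has_cohomology_exists[of x t] has_cohomology_exists[of z t] has_cohomology_tri[OF _ _ assms]
    tri_ob[OF assms] cohomology_height_eq by metis

lemma cohomology_height_retract:
  assumes "retract x y" shows "cohomology_height x t \<le> cohomology_height y t"
proof -
  have "x \<in> Ob C" "y \<in> Ob C" using assms hom_ob unfolding retract_def by blast+
  then show ?thesis
    using has_cohomology_exists[of x t] has_cohomology_exists[of y t] has_cohomology_retract[OF _ _ assms]
      cohomology_height_eq by metis
qed

section \<open>The mass under triangles, retracts and shifts\<close>

definition mass_sum :: "real \<Rightarrow> nat \<Rightarrow> (nat \<Rightarrow> 'a) \<Rightarrow> (nat \<Rightarrow> real) \<Rightarrow> real" where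
  "mass_sum q n a \<phi> = (\<Sum>i<n. q powr \<phi> i * cmod (\<zeta> (a i)))"

lemma has_integral_mass_sum:
  assumes "q > 0" "HN_filtration C P y n x a \<phi>"
  shows "((\<lambda>t. q powr t * cohomology_height y t) has_integral (pi * (1 + 1 / q) / ((ln q)\<^sup>2 + pi\<^sup>2) * mass_sum q n a \<phi>)) UNIV"
    (is "(_ has_integral (?c * _)) _")
proof -
  let ?w = "\<lambda>p t. if t \<in> {p - 1..p} then q powr t * sin (pi * (p - t)) else 0"
  have "q powr t * cohomology_height y t = (\<Sum>i<n. cmod (\<zeta> (a i)) * ?w (\<phi> i) t)" for t
  proof -
    \<comment> \<open>The closed interval in \<open>?w\<close> includes \<open>t = \<phi> i\<close>,
      which the strict inequality excludes; the sine vanishes there.\<close>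
    have "(\<Sum>i<n. cmod (\<zeta> (a i)) * ?w (\<phi> i) t) =
        (\<Sum>i<n. if t < \<phi> i \<and> \<phi> i \<le> t + 1 then q powr t * (cmod (\<zeta> (a i)) * sin (pi * (\<phi> i - t))) else 0)"
      by (rule sum.cong) auto
    also have "\<dots> = (\<Sum>i | i < n \<and> t < \<phi> i \<and> \<phi> i \<le> t + 1. q powr t * (cmod (\<zeta> (a i)) * sin (pi * (\<phi> i - t))))"
      by (subst sum.inter_filter[symmetric]) (auto intro: sum.cong)
    finally show ?thesis unfolding cohomology_height_HN[OF assms(2)] sum_distrib_left by simp
  qed
  moreover have "((\<lambda>t. \<Sum>i<n. cmod (\<zeta> (a i)) * ?w (\<phi> i) t) has_integral
      (\<Sum>i<n. cmod (\<zeta> (a i)) * (?c * q powr \<phi> i))) UNIV"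
    by (intro has_integral_sum has_integral_mult_right has_integral_powr_sin assms finite_lessThan)
  moreover have "(\<Sum>i<n. cmod (\<zeta> (a i)) * (?c * q powr \<phi> i)) = ?c * mass_sum q n a \<phi>"
    unfolding mass_sum_def sum_distrib_left by (rule sum.cong) (simp_all add: algebra_simps)
  ultimately show ?thesis by simp
qed

definition total_mass :: "real \<Rightarrow> 'a \<Rightarrow> real" where
  "total_mass q y = (THE m. \<exists>n x a \<phi>. HN_filtration C P y n x a \<phi> \<and> m = mass_sum q n a \<phi>)"

lemma mass_const_pos: "q > 0 \<Longrightarrow> 0 < pi * (1 + 1 / q) / ((ln q)\<^sup>2 + pi\<^sup>2)"
  by (intro divide_pos_pos mult_pos_pos add_nonneg_pos add_pos_pos) auto

lemma total_mass_eq: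
  assumes "q > 0" "HN_filtration C P y n x a \<phi>" shows "total_mass q y = mass_sum q n a \<phi>"
proof -
  have "m = mass_sum q n a \<phi>" if "\<exists>n x a \<phi>. HN_filtration C P y n x a \<phi> \<and> m = mass_sum q n a \<phi>" for m
    using that has_integral_unique[OF has_integral_mass_sum[OF assms] has_integral_mass_sum[OF assms(1)]]
      mass_const_pos[OF assms(1)] by (metis less_irrefl mult_cancel_left)
  then show ?thesis unfolding total_mass_def using assms(2) by (intro the_equality) blast+
qed

lemma has_integral_total_mass:
  assumes "q > 0" "y \<in> Ob C"
  shows "((\<lambda>t. q powr t * cohomology_height y t) has_integral (pi * (1 + 1 / q) / ((ln q)\<^sup>2 + pi\<^sup>2) * total_mass q y)) UNIV"
proof -
  obtain n x a \<phi> where HN: "HN_filtration C P y n x a \<phi>" using HN_exists assms(2) by blast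
  then show ?thesis using has_integral_mass_sum[OF assms(1) HN] total_mass_eq[OF assms(1) HN] by simp
qed

lemma total_mass_tri:
  assumes "q > 0" "tri x y z" shows "total_mass q y \<le> total_mass q x + total_mass q z"
proof -
  define c where "c = pi * (1 + 1 / q) / ((ln q)\<^sup>2 + pi\<^sup>2)"
  have c: "c > 0" unfolding c_def using mass_const_pos assms(1) .
  note I = has_integral_total_mass[OF assms(1), folded c_def]
  have "c * total_mass q y \<le> c * total_mass q x + c * total_mass q z"
  proof (rule has_integral_le[OF I has_integral_add[OF I I]])
    fix t
    show "q powr t * cohomology_height y t \<le> q powr t * cohomology_height x t + q powr t * cohomology_height z t"
      using mult_left_mono[OF cohomology_height_tri[OF assms(2)], of "q powr t" t] by (simp add: distrib_left)
  qed (use tri_ob[OF assms(2)] in auto)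
  then have "c * total_mass q y \<le> c * (total_mass q x + total_mass q z)" by (simp add: distrib_left)
  then show ?thesis using c by simp
qed

lemma total_mass_retract:
  assumes "q > 0" "retract x y" shows "total_mass q x \<le> total_mass q y"
proof -
  have ob: "x \<in> Ob C" "y \<in> Ob C" using assms hom_ob unfolding retract_def by blast+
  have "q powr t * cohomology_height x t \<le> q powr t * cohomology_height y t" for t
    using cohomology_height_retract[OF assms(2)] by (simp add: mult_left_mono)
  then have "pi * (1 + 1 / q) / ((ln q)\<^sup>2 + pi\<^sup>2) * total_mass q x \<le> pi * (1 + 1 / q) / ((ln q)\<^sup>2 + pi\<^sup>2) * total_mass q y"
    by (intro has_integral_le[OF has_integral_total_mass has_integral_total_mass] assms ob)
  then show ?thesis using mass_const_pos[OF assms(1)] by (simp only: mult_le_cancel_left_pos)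
qed

lemma total_mass_nonneg:
  assumes "q > 0" "y \<in> Ob C" shows "0 \<le> total_mass q y"
proof -
  obtain n x a \<phi> where HN: "HN_filtration C P y n x a \<phi>" using HN_exists assms(2) by blast
  show ?thesis unfolding total_mass_eq[OF assms(1) HN] mass_sum_def by (intro sum_nonneg) simp
qed

lemma total_mass_pos:
  assumes "q > 0" "y \<in> Ob C" "\<not> zero_object C y" shows "0 < total_mass q y"
proof -
  obtain n x a \<phi> where HN: "HN_filtration C P y n x a \<phi>" using HN_exists assms(2) by blast
  \<comment> \<open>An empty filtration would make \<open>y = x 0\<close> a zero object.\<close>
  have "n \<noteq> 0" using HN assms(3) unfolding HN_filtration_def filtration_def by (metis)
  moreover have "0 < q powr \<phi> i * cmod (\<zeta> (a i))" if "i < n" for i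
  proof -
    have "a i \<in> P (\<phi> i)" "\<not> zero_object C (a i)" using HN that unfolding HN_filtration_def by auto
    then obtain m where "m > 0" "\<zeta> (a i) = complex_of_real m * cis (pi * \<phi> i)" using charge_P by blast
    then have "cmod (\<zeta> (a i)) > 0" by (simp add: norm_mult)
    then show ?thesis using assms(1) by simp
  qed
  ultimately show ?thesis
    unfolding total_mass_eq[OF assms(1) HN] mass_sum_def by (intro sum_pos) auto
qed

lemma total_mass_zero: "q > 0 \<Longrightarrow> zero_object C y \<Longrightarrow> total_mass q y = 0"
  using total_mass_eq[of q y 0 "\<lambda>_. y"] unfolding mass_sum_def HN_filtration_def filtration_def by simp

lemma total_mass_iso:
  assumes "q > 0" "isomorphic C x y" shows "total_mass q x = total_mass q y"
proof -
  have "retract x y" "retract y x"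
    using assms(2) unfolding isomorphic_def is_iso_def retract_def by blast+
  then show ?thesis using total_mass_retract[OF assms(1)] order_antisym by blast
qed

text \<open>Shifting a filtration raises all phases by one, whence the factor \<open>q\<close>, and
  only changes the sign of the charge.\<close>

lemma total_mass_sh:
  assumes "q > 0" "y \<in> Ob C" shows "total_mass q (sh y) = q * total_mass q y"
proof -
  obtain n x a \<phi> where HN: "HN_filtration C P y n x a \<phi>" using HN_exists assms(2) by blast
  have a: "a i \<in> P (\<phi> i)" "\<not> zero_object C (a i)" "tri (x i) (x (Suc i)) (a i)" if "i < n" for i
    using HN that unfolding HN_filtration_def filtration_def by auto
  have x: "zero_object C (x 0)" "x n = y" using HN unfolding HN_filtration_def filtration_def by auto
  have "HN_filtration C P (sh y) n (\<lambda>i. sh (x i)) (\<lambda>i. sh (a i)) (\<lambda>i. \<phi> i + 1)"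
    unfolding HN_filtration_def filtration_def
  proof (intro conjI allI impI)
    show "zero_object C (sh (x 0))" using zero_object_sh[OF zero_object_ob] x by blast
    show "tri (sh (x i)) (sh (x (Suc i))) (sh (a i))" if "i < n" for i using a that tri_sh by blast
    show "sh (a i) \<in> P (\<phi> i + 1)" if "i < n" for i using a that P_sh by blast
    show "\<not> zero_object C (sh (a i))" if "i < n" for i using a that zero_object_sh P_ob by blast
    show "\<phi> j + 1 < \<phi> i + 1" if "i < j \<and> j < n" for i j using HN that unfolding HN_filtration_def by simp
  qed (use x in simp)
  then have "total_mass q (sh y) = mass_sum q n (\<lambda>i. sh (a i)) (\<lambda>i. \<phi> i + 1)"
    using total_mass_eq assms by blast
  also have "\<dots> = q * mass_sum q n a \<phi>"
  proof -
    have "cmod (\<zeta> (sh w)) = cmod (\<zeta> w)" if "w \<in> Ob C" for w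
    proof -
      obtain z where z: "zero_object C z" using ex_zero_object by blast
      have "\<zeta> z = \<zeta> w + \<zeta> (sh w)" using charge_tri[OF tri_rotate[OF tri_id[OF that z]]] .
      then have "\<zeta> (sh w) = - \<zeta> w" using charge_zero[OF z] by (simp add: eq_neg_iff_add_eq_0 add.commute)
      then show ?thesis by simp
    qed
    then show ?thesis unfolding mass_sum_def sum_distrib_left
      using a(1) P_ob assms(1) by (intro sum.cong) (auto simp: powr_add)
  qed
  finally show ?thesis using total_mass_eq[OF assms(1) HN] by simp
qed

lemma total_mass_funpow_sh: "q > 0 \<Longrightarrow> y \<in> Ob C \<Longrightarrow> total_mass q ((sh ^^ k) y) = q ^ k * total_mass q y"
proof (induction k)
  case (Suc k)
  have "(sh ^^ k) y \<in> Ob C" using Suc.prems(2) sh_ob by (induction k) auto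
  then show ?case using Suc total_mass_sh by simp
qed simp

text \<open>The sum of both powers serves for either direction of the shift.\<close>

lemma total_mass_shift:
  assumes "q > 0" "p \<in> Ob C" "x \<in> Ob C" "isomorphic C x ((sh ^^ k) p) \<or> isomorphic C ((sh ^^ k) x) p"
  shows "total_mass q x \<le> (q ^ k + 1 / q ^ k) * total_mass q p"
  using assms(4)
proof
  have p: "0 \<le> total_mass q p" using total_mass_nonneg assms by blast
  {
    assume "isomorphic C x ((sh ^^ k) p)"
    then have "total_mass q x = q ^ k * total_mass q p"
      using total_mass_iso total_mass_funpow_sh assms by simp
    also have "\<dots> \<le> (q ^ k + 1 / q ^ k) * total_mass q p"
      using p assms(1) by (intro mult_right_mono) auto
    finally show ?thesis .
  next
    assume "isomorphic C ((sh ^^ k) x) p"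
    then have "q ^ k * total_mass q x = total_mass q p"
      using total_mass_iso[OF assms(1)] total_mass_funpow_sh[OF assms(1,3)] by metis
    then have "total_mass q x = 1 / q ^ k * total_mass q p" using assms(1) by (simp add: field_simps)
    also have "\<dots> \<le> (q ^ k + 1 / q ^ k) * total_mass q p"
      using p assms(1) by (intro mult_right_mono) auto
    finally show ?thesis .
  }
qed

lemma total_mass_filtration:
  assumes "q > 0" "filtration C n x a" "i \<le> n" shows "total_mass q (x i) \<le> (\<Sum>j<i. total_mass q (a j))"
  using assms(3)
proof (induction i)
  case 0
  then show ?case using total_mass_zero assms(1,2) unfolding filtration_def by simp
next
  case (Suc i)
  then have "tri (x i) (x (Suc i)) (a i)" using assms(2) unfolding filtration_def by simp
  then show ?case using total_mass_tri[OF assms(1)] Suc by fastforce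
qed

end

section \<open>Bounds from a generator\<close>

context additive_category
begin

text \<open>Membership of the sum is proved in the same induction, because distributivity requires
  it at each step.\<close>

lemma cmp_finprod_right:
  assumes "finite I" "\<And>i. i \<in> I \<Longrightarrow> f i \<in> Hom C x y" "g \<in> Hom C y z" "x \<in> Ob C"
  shows "g \<diamondop> finprod (hom_group C x y) f I = finprod (hom_group C x z) (\<lambda>i. g \<diamondop> f i) I
    \<and> finprod (hom_group C x y) f I \<in> Hom C x y"
proof -
  have ob: "y \<in> Ob C" "z \<in> Ob C" using assms(3) hom_ob by blast+
  interpret xy: comm_group "hom_group C x y" using hom_comm_group ob assms(4) by blast
  interpret xz: comm_group "hom_group C x z" using hom_comm_group ob assms(4) by blast
  show ?thesis
    using assms(1,2)
  proof (induction I)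
    case empty
    then show ?case using cmp_zero_right[OF assms(4,3)] zero_closed ob assms(4) by simp
  next
    case (insert i I)
    have f: "f i \<in> Hom C x y" "f \<in> I \<rightarrow> Hom C x y" using insert by auto
    then have "(\<lambda>i. g \<diamondop> f i) \<in> I \<rightarrow> Hom C x z" "g \<diamondop> f i \<in> Hom C x z"
      using cmp_closed assms(3) by blast+
    then show ?case
      using insert f cmp_add_right[OF f(1) _ assms(3)] add_closed by simp
  qed
qed

lemma cmp_finprod_left:
  assumes "finite I" "\<And>i. i \<in> I \<Longrightarrow> f i \<in> Hom C y z" "g \<in> Hom C x y" "z \<in> Ob C"
  shows "finprod (hom_group C y z) f I \<diamondop> g = finprod (hom_group C x z) (\<lambda>i. f i \<diamondop> g) I
    \<and> finprod (hom_group C y z) f I \<in> Hom C y z"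
proof -
  have ob: "x \<in> Ob C" "y \<in> Ob C" using assms(3) hom_ob by blast+
  interpret yz: comm_group "hom_group C y z" using hom_comm_group ob assms(4) by blast
  interpret xz: comm_group "hom_group C x z" using hom_comm_group ob assms(4) by blast
  show ?thesis
    using assms(1,2)
  proof (induction I)
    case empty
    then show ?case using cmp_zero_left[OF assms(4,3)] zero_closed ob assms(4) by simp
  next
    case (insert i I)
    have f: "f i \<in> Hom C y z" "f \<in> I \<rightarrow> Hom C y z" using insert by auto
    then have "(\<lambda>i. f i \<diamondop> g) \<in> I \<rightarrow> Hom C x z" "f i \<diamondop> g \<in> Hom C x z"
      using cmp_closed assms(3) by blast+
    then show ?case
      using insert f cmp_add_left[OF assms(3) f(1)] add_closed by simp
  qed
qed

end

context triangulated_category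
begin

text \<open>Splitting off one summand by a triangle makes direct sums accessible to subadditivity.
  The other projections kill \<open>\<iota> i\<close>, hence descend to the cone; that the new
  idempotents sum to the identity is tested after composing with \<open>g\<close>, an epimorphism
  since the connecting map vanishes.\<close>

lemma direct_sum_insert:
  assumes "is_direct_sum C (insert i I) x s" "i \<notin> I"
  shows "\<exists>c. is_direct_sum C I x c \<and> tri (x i) s c"
proof -
  have fin: "finite I" and s: "s \<in> Ob C" and x: "\<And>j. j \<in> insert i I \<Longrightarrow> x j \<in> Ob C"
    using assms(1) unfolding is_direct_sum_def by auto
  obtain \<iota> \<pi> where *: "\<forall>j\<in>insert i I. \<iota> j \<in> Hom C (x j) s \<and> \<pi> j \<in> Hom C s (x j)"
    and **: "\<forall>j\<in>insert i I. \<forall>k\<in>insert i I.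
      \<pi> k \<diamondop> \<iota> j = (if j = k then idm C (x j) else zerom C (x j) (x k))"
    and sum: "finprod (hom_group C s s) (\<lambda>j. \<iota> j \<diamondop> \<pi> j) (insert i I) = idm C s"
    using assms(1) unfolding is_direct_sum_def by (elim conjE exE)
  have \<iota>: "\<iota> j \<in> Hom C (x j) s" and \<pi>: "\<pi> j \<in> Hom C s (x j)" if "j \<in> insert i I" for j
    using * that by auto
  have \<pi>\<iota>: "\<pi> k \<diamondop> \<iota> j = (if j = k then idm C (x j) else zerom C (x j) (x k))"
    if "j \<in> insert i I" "k \<in> insert i I" for j k
    using ** that by blast
  have \<iota>i: "\<iota> i \<in> Hom C (x i) s" and \<pi>i: "\<pi> i \<in> Hom C s (x i)" using \<iota> \<pi> by auto
  obtain c g h where d0: "tricat.dist C (x i) s c (\<iota> i) g h" using TR1_cone[OF \<iota>i] by blast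
  have g: "g \<in> Hom C s c" using dist_typed[OF d0] by blast
  have c: "c \<in> Ob C" using g hom_ob by blast
  have "h = zerom C c (sh (x i))" using dist_split_mono[OF d0 \<pi>i] \<pi>\<iota>[of i i] by simp
  with d0 have d: "tricat.dist C (x i) s c (\<iota> i) g (zerom C c (sh (x i)))" by simp
  have "\<exists>l. l \<in> Hom C c (x j) \<and> l \<diamondop> g = \<pi> j" if "j \<in> I" for j
  proof -
    have "\<pi> j \<diamondop> \<iota> i = zerom C (x i) (x j)" using \<pi>\<iota>[of i j] that assms(2) by auto
    then show ?thesis using dist_extend[OF d \<pi>[of j]] that by blast
  qed
  then obtain \<pi>' where \<pi>': "\<And>j. j \<in> I \<Longrightarrow> \<pi>' j \<in> Hom C c (x j) \<and> \<pi>' j \<diamondop> g = \<pi> j" by metis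
  define \<iota>' where "\<iota>' j = g \<diamondop> \<iota> j" for j
  have \<iota>': "\<iota>' j \<in> Hom C (x j) c" if "j \<in> I" for j
    unfolding \<iota>'_def using cmp_closed[OF \<iota> g] that by blast
  have "\<pi>' k \<diamondop> \<iota>' j = (if j = k then idm C (x j) else zerom C (x j) (x k))" if "j \<in> I" "k \<in> I" for j k
  proof -
    have k: "\<pi>' k \<in> Hom C c (x k)" "\<pi>' k \<diamondop> g = \<pi> k" using \<pi>' that by auto
    have "\<pi>' k \<diamondop> \<iota>' j = \<pi> k \<diamondop> \<iota> j"
      unfolding \<iota>'_def using cmp_assoc[OF \<iota> g k(1), of j] k(2) that by simp
    then show ?thesis using \<pi>\<iota>[of j k] that by simp
  qed
  moreover have "finprod (hom_group C c c) (\<lambda>j. \<iota>' j \<diamondop> \<pi>' j) I = idm C c"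
  proof (rule dist_epi[OF d])
    interpret sc: comm_group "hom_group C s c" using hom_comm_group s c .
    have e: "\<iota>' j \<diamondop> \<pi>' j \<in> Hom C c c" if "j \<in> I" for j using cmp_closed \<iota>' \<pi>' that by blast
    have e': "(\<iota>' j \<diamondop> \<pi>' j) \<diamondop> g = g \<diamondop> (\<iota> j \<diamondop> \<pi> j)" if j: "j \<in> I" for j
    proof -
      have "(\<iota>' j \<diamondop> \<pi>' j) \<diamondop> g = \<iota>' j \<diamondop> \<pi> j"
        using cmp_assoc[OF g _ \<iota>'[OF j]] \<pi>'[OF j] by simp
      also have "\<dots> = g \<diamondop> (\<iota> j \<diamondop> \<pi> j)"
        unfolding \<iota>'_def using cmp_assoc[OF \<pi> \<iota> g, of j] j by simp
      finally show ?thesis .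
    qed
    have gf: "g \<diamondop> (\<iota> j \<diamondop> \<pi> j) \<in> Hom C s c" if "j \<in> insert i I" for j
      using cmp_closed[OF cmp_closed[OF \<pi>[OF that] \<iota>[OF that]] g] .
    \<comment> \<open>The summand split off contributes nothing after \<open>g\<close>.\<close>
    have "g \<diamondop> (\<iota> i \<diamondop> \<pi> i) = (g \<diamondop> \<iota> i) \<diamondop> \<pi> i" using cmp_assoc[OF \<pi>i \<iota>i g] by simp
    then have i0: "g \<diamondop> (\<iota> i \<diamondop> \<pi> i) = zerom C s c"
      using dist_cmp_zero[OF d] cmp_zero_left[OF c \<pi>i] by simp
    have "idm C c \<diamondop> g = g \<diamondop> finprod (hom_group C s s) (\<lambda>j. \<iota> j \<diamondop> \<pi> j) (insert i I)"
      unfolding sum using cmp_id_left[OF g] cmp_id_right[OF g] by simp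
    also have "\<dots> = finprod (hom_group C s c) (\<lambda>j. g \<diamondop> (\<iota> j \<diamondop> \<pi> j)) (insert i I)"
      using cmp_finprod_right[OF _ _ g s, of "insert i I"] cmp_closed[OF \<pi> \<iota>] fin by simp
    also have "\<dots> = addm C (zerom C s c) (finprod (hom_group C s c) (\<lambda>j. g \<diamondop> (\<iota> j \<diamondop> \<pi> j)) I)"
      using sc.finprod_insert[OF fin assms(2), of "\<lambda>j. g \<diamondop> (\<iota> j \<diamondop> \<pi> j)"] gf i0
        gf[of i] by auto
    also have "\<dots> = finprod (hom_group C s c) (\<lambda>j. g \<diamondop> (\<iota> j \<diamondop> \<pi> j)) I"
    proof -
      have "finprod (hom_group C s c) (\<lambda>j. g \<diamondop> (\<iota> j \<diamondop> \<pi> j)) I \<in> carrier (hom_group C s c)"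
        by (rule sc.finprod_closed) (use gf in auto)
      then show ?thesis using zero_add by simp
    qed
    also have "\<dots> = finprod (hom_group C s c) (\<lambda>j. (\<iota>' j \<diamondop> \<pi>' j) \<diamondop> g) I"
      by (rule sc.finprod_cong') (use e' gf in auto)
    also have "\<dots> = finprod (hom_group C c c) (\<lambda>j. \<iota>' j \<diamondop> \<pi>' j) I \<diamondop> g"
      using cmp_finprod_left[OF fin e g c] by simp
    finally show "finprod (hom_group C c c) (\<lambda>j. \<iota>' j \<diamondop> \<pi>' j) I \<diamondop> g = idm C c \<diamondop> g" by simp
    show "finprod (hom_group C c c) (\<lambda>j. \<iota>' j \<diamondop> \<pi>' j) I \<in> Hom C c c"
      using cmp_finprod_left[OF fin e g c] by simp
    show "idm C c \<in> Hom C c c" using id_closed c .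
  qed
  ultimately have "is_direct_sum C I x c"
    unfolding is_direct_sum_def using fin c x \<iota>' \<pi>' by blast
  then show ?thesis using d unfolding ex_triangle_def by blast
qed

lemma direct_sum_empty:
  fixes x :: "'i \<Rightarrow> 'a"
  assumes "is_direct_sum C {} x s" shows "zero_object C s"
proof -
  have s: "s \<in> Ob C" using assms unfolding is_direct_sum_def by blast
  obtain f :: "'i \<Rightarrow> 'b" where f: "finprod (hom_group C s s) f {} = idm C s"
    using assms unfolding is_direct_sum_def by (elim conjE exE) (rule that)
  interpret comm_group "hom_group C s s" using hom_comm_group s s .
  show ?thesis using f finprod_empty zero_object_iff_id[OF s] by simp
qed

end
context triangulated_category
begin

text \<open>The filtration exhibiting \<open>y\<close> from \<open>p\<close> lives in the category
  alone; fixing it before \<open>P\<close> and \<open>\<zeta>\<close> are introduced makes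
  \<open>K\<close> uniform.\<close>

lemma generator_mass_bound:
  assumes "q > 0" "classical_generator C p" "y \<in> Ob C"
  shows "\<exists>K\<ge>0. \<forall>P \<zeta>. slicing_charge C P \<zeta> \<longrightarrow>
    slicing_charge.total_mass C P \<zeta> q y \<le> K * slicing_charge.total_mass C P \<zeta> q p"
proof -
  obtain m x a where f: "filtration C (Suc m) x a" and "\<forall>i\<le>m. is_shift_of C p (a i)"
      and y: "direct_summand C y (x (Suc m))"
    using assms(2,3) unfolding classical_generator_def by blast
  then have "\<forall>i. \<exists>k. i \<le> m \<longrightarrow> a i \<in> Ob C \<and>
      (isomorphic C (a i) ((sh ^^ k) p) \<or> isomorphic C ((sh ^^ k) (a i)) p)"
    unfolding is_shift_of_def by blast
  then obtain k where k: "\<And>i. i \<le> m \<Longrightarrow> a i \<in> Ob C \<and>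
      (isomorphic C (a i) ((sh ^^ k i) p) \<or> isomorphic C ((sh ^^ k i) (a i)) p)" by metis
  have p: "p \<in> Ob C" using assms(2) unfolding classical_generator_def by blast
  define K where "K = (\<Sum>i<Suc m. q ^ k i + 1 / q ^ k i)"
  have "slicing_charge.total_mass C P \<zeta> q y \<le> K * slicing_charge.total_mass C P \<zeta> q p"
    if "slicing_charge C P \<zeta>" for P \<zeta>
  proof -
    interpret slicing_charge C P \<zeta> by fact
    have "total_mass q y \<le> total_mass q (x (Suc m))"
      using total_mass_retract[OF assms(1) direct_summand_retract[OF y]] .
    also have "\<dots> \<le> (\<Sum>i<Suc m. total_mass q (a i))"
      using total_mass_filtration[OF assms(1) f order_refl] .
    also have "\<dots> \<le> (\<Sum>i<Suc m. (q ^ k i + 1 / q ^ k i) * total_mass q p)"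
      using k by (intro sum_mono total_mass_shift assms(1) p) auto
    finally show ?thesis unfolding K_def sum_distrib_right .
  qed
  moreover have "K \<ge> 0" unfolding K_def using assms(1) by (intro sum_nonneg) auto
  ultimately show ?thesis by blast
qed

end

section \<open>Stability conditions\<close>
context triangulated_category
begin

text \<open>The two representatives differ by a generator of the relations, so their cosets
  coincide.\<close>

lemma K0_class_tri:
  assumes "tri x y z"
  shows "K0_class C y = K0_class C x \<otimes>\<^bsub>K0 C\<^esub> K0_class C z"
proof -
  let ?G = "free_Abelian_group (Ob C)" and ?R = "K0_relations C"
  interpret comm_group ?G by (rule abelian_free_Abelian_group)
  have gen: "frag_of y \<in> carrier ?G" if "y \<in> Ob C" for y using that by simp
  have rel: "{frag_of y - frag_of x - frag_of z | x y z. tri x y z} \<subseteq> carrier ?G"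
  proof (clarify)
    fix x y z assume "tri x y z"
    then have "Poly_Mapping.keys (frag_of x) \<subseteq> Ob C" "Poly_Mapping.keys (frag_of y) \<subseteq> Ob C"
      "Poly_Mapping.keys (frag_of z) \<subseteq> Ob C"
      using tri_ob by auto
    then show "frag_of y - frag_of x - frag_of z \<in> carrier ?G"
      using keys_diff[of "frag_of y - frag_of x" "frag_of z"] keys_diff[of "frag_of y" "frag_of x"] by auto
  qed
  have sub: "subgroup ?R ?G" unfolding K0_relations_def using generate_is_subgroup[OF rel] .
  have ob: "frag_of x \<in> carrier ?G" "frag_of y \<in> carrier ?G" "frag_of z \<in> carrier ?G"
    using tri_ob[OF assms] by auto
  have xz: "frag_of x + frag_of z \<in> carrier ?G" using m_closed[OF ob(1,3)] by simp
  interpret normal ?R ?G using sub normal_iff_subgroup by blast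
  have "frag_of y - frag_of x - frag_of z \<in> ?R"
    unfolding K0_relations_def using assms by (intro generate.incl) blast
  then have "frag_of y \<in> ?R #>\<^bsub>?G\<^esub> (frag_of x + frag_of z)"
    unfolding r_coset_def by (force simp: algebra_simps)
  then have "?R #>\<^bsub>?G\<^esub> (frag_of x + frag_of z) = ?R #>\<^bsub>?G\<^esub> frag_of y"
    using repr_independence[OF _ xz sub] by blast
  moreover have "(?R #>\<^bsub>?G\<^esub> frag_of x) <#>\<^bsub>?G\<^esub> (?R #>\<^bsub>?G\<^esub> frag_of z) = ?R #>\<^bsub>?G\<^esub> (frag_of x + frag_of z)"
    using rcos_sum[OF ob(1,3)] by simp
  ultimately show ?thesis unfolding K0_class_def K0_def FactGroup_def by simp
qed

lemma K0_class_closed: "x \<in> Ob C \<Longrightarrow> K0_class C x \<in> carrier (K0 C)"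
  unfolding K0_class_def K0_def FactGroup_def RCOSETS_def by auto

lemma Stab_slicing_charge:
  assumes "\<tau> \<in> Stab C" shows "slicing_charge C (fst \<tau>) (\<lambda>x. snd \<tau> (K0_class C x))"
proof -
  obtain P Z where \<tau>: "\<tau> = (P, Z)" by fastforce
  have P: "is_slicing C P" and Z: "Z \<in> hom (K0 C) complex_group"
    and m: "\<And>\<phi> x. x \<in> P \<phi> \<Longrightarrow> \<not> zero_object C x \<Longrightarrow>
      \<exists>m>0. Z (K0_class C x) = complex_of_real m * cis (pi * \<phi>)"
    using assms unfolding Stab_def \<tau> by auto
  interpret slicing C P by unfold_locales (rule P)
  show ?thesis
    unfolding \<tau> fst_conv snd_conv
  proof unfold_locales
    show "tri_additive (\<lambda>x. Z (K0_class C x))"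
      unfolding tri_additive_def
      using hom_mult[OF Z K0_class_closed K0_class_closed] K0_class_tri tri_ob
      by (simp add: complex_group_def)
  qed (rule m)
qed

lemma mass_eq_total_mass:
  assumes "\<tau> \<in> Stab C"
  shows "mass C q \<tau> y = slicing_charge.total_mass C (fst \<tau>) (\<lambda>x. snd \<tau> (K0_class C x)) q y"
proof -
  interpret slicing_charge C "fst \<tau>" "\<lambda>x. snd \<tau> (K0_class C x)" using Stab_slicing_charge assms .
  show ?thesis unfolding mass_def total_mass_def mass_sum_def ..
qed

lemma mass_pos:
  assumes "\<tau> \<in> Stab C" "q > 0" "y \<in> Ob C" "\<not> zero_object C y" shows "0 < mass C q \<tau> y"
proof -
  interpret slicing_charge C "fst \<tau>" "\<lambda>x. snd \<tau> (K0_class C x)" using Stab_slicing_charge assms(1) .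
  show ?thesis using total_mass_pos assms(2-) mass_eq_total_mass[OF assms(1)] by simp
qed

text \<open>The same objects filter \<open>y\<close>, with phases moved by
  \<open>Im \<omega> / pi\<close>; as \<open>exp \<omega>\<close> has modulus
  \<open>exp (Re \<omega>)\<close>, the factor is the same for all \<open>y\<close>.\<close>

lemma mass_C_action:
  assumes "\<tau> \<in> Stab C" "C_action C \<omega> \<tau> \<in> Stab C" "q > 0" "y \<in> Ob C"
  shows "mass C q (C_action C \<omega> \<tau>) y = q powr (Im \<omega> / pi) * exp (Re \<omega>) * mass C q \<tau> y"
proof -
  let ?\<tau> = "C_action C \<omega> \<tau>"
  interpret A: slicing_charge C "fst \<tau>" "\<lambda>x. snd \<tau> (K0_class C x)" using Stab_slicing_charge assms(1) .
  interpret B: slicing_charge C "fst ?\<tau>" "\<lambda>x. snd ?\<tau> (K0_class C x)" using Stab_slicing_charge assms(2) .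
  obtain n x a \<phi> where HN: "HN_filtration C (fst \<tau>) y n x a \<phi>" using A.HN_exists assms(4) by blast
  have "HN_filtration C (fst ?\<tau>) y n x a (\<lambda>i. \<phi> i + Im \<omega> / pi)"
    using HN unfolding HN_filtration_def C_action_def by simp
  then have "mass C q ?\<tau> y = B.mass_sum q n a (\<lambda>i. \<phi> i + Im \<omega> / pi)"
    using B.total_mass_eq assms(3) mass_eq_total_mass[OF assms(2)] by simp
  also have "\<dots> = (\<Sum>i<n. q powr (Im \<omega> / pi) * exp (Re \<omega>) * (q powr \<phi> i * cmod (snd \<tau> (K0_class C (a i)))))"
    unfolding B.mass_sum_def
  proof (rule sum.cong[OF refl])
    fix i assume "i \<in> {..<n}"
    then have "a i \<in> Ob C" using HN A.P_ob unfolding HN_filtration_def by blast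
    then have "snd ?\<tau> (K0_class C (a i)) = exp \<omega> * snd \<tau> (K0_class C (a i))"
      unfolding C_action_def using K0_class_closed by simp
    then show "q powr (\<phi> i + Im \<omega> / pi) * cmod (snd ?\<tau> (K0_class C (a i))) =
        q powr (Im \<omega> / pi) * exp (Re \<omega>) * (q powr \<phi> i * cmod (snd \<tau> (K0_class C (a i))))"
      by (simp add: powr_add norm_mult)
  qed
  also have "\<dots> = q powr (Im \<omega> / pi) * exp (Re \<omega>) * mass C q \<tau> y"
    using A.total_mass_eq[OF assms(3) HN] mass_eq_total_mass[OF assms(1)]
    unfolding A.mass_sum_def by (simp add: sum_distrib_left)
  finally show ?thesis .
qed

lemma mass_direct_sum:
  assumes "\<tau> \<in> Stab C" "q > 0" "finite I" "is_direct_sum C I x s"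
  shows "mass C q \<tau> s \<le> (\<Sum>i\<in>I. mass C q \<tau> (x i))"
proof -
  interpret slicing_charge C "fst \<tau>" "\<lambda>x. snd \<tau> (K0_class C x)" using Stab_slicing_charge assms(1) .
  have "total_mass q s \<le> (\<Sum>i\<in>I. total_mass q (x i))"
    using assms(3,4)
  proof (induction I arbitrary: s)
    case empty
    then show ?case using direct_sum_empty total_mass_zero assms(2) by force
  next
    case (insert i I)
    obtain c where "is_direct_sum C I x c" "tri (x i) s c"
      using direct_sum_insert[OF insert.prems insert.hyps(2)] by blast
    then show ?case using insert.IH[of c] insert.hyps total_mass_tri[OF assms(2), of "x i" s c] by simp
  qed
  then show ?thesis unfolding mass_eq_total_mass[OF assms(1)] .
qed

lemma generator_sum_mass_bound:
  assumes "q > 0" "classical_generator C p" "finite I" "is_direct_sum C I x p" "y \<in> Ob C"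
  shows "\<exists>K\<ge>0. \<forall>\<tau>\<in>Stab C. mass C q \<tau> y \<le> K * (\<Sum>i\<in>I. mass C q \<tau> (x i))"
proof -
  obtain K where K: "K \<ge> 0" "\<forall>P \<zeta>. slicing_charge C P \<zeta> \<longrightarrow>
      slicing_charge.total_mass C P \<zeta> q y \<le> K * slicing_charge.total_mass C P \<zeta> q p"
    using generator_mass_bound[OF assms(1,2,5)] by blast
  have "mass C q \<tau> y \<le> K * (\<Sum>i\<in>I. mass C q \<tau> (x i))" if \<tau>: "\<tau> \<in> Stab C" for \<tau>
  proof -
    have "mass C q \<tau> y \<le> K * mass C q \<tau> p"
      unfolding mass_eq_total_mass[OF \<tau>] using K(2) Stab_slicing_charge[OF \<tau>] by blast
    also have "\<dots> \<le> K * (\<Sum>i\<in>I. mass C q \<tau> (x i))"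
      using mass_direct_sum[OF \<tau> assms(1,3,4)] K(1) by (rule mult_left_mono)
    finally show ?thesis .
  qed
  then show ?thesis using K(1) by blast
qed

end

section \<open>Compactness in projective space\<close>
lemma proj_class_scale:
  assumes "c \<noteq> 0" shows "proj_class S (\<lambda>s\<in>S. c * f s) = proj_class S f"
proof -
  have "\<exists>d. d \<noteq> 0 \<and> (\<lambda>s\<in>S. b * f s) = (\<lambda>s\<in>S. d * (\<lambda>s\<in>S. c * f s) s)" if "b \<noteq> 0" for b
    using assms that by (intro exI[of _ "b / c"]) auto
  moreover have "\<exists>d. d \<noteq> 0 \<and> (\<lambda>s\<in>S. b * (\<lambda>s\<in>S. c * f s) s) = (\<lambda>s\<in>S. d * f s)" if "b \<noteq> 0" for b
    using assms that by (intro exI[of _ "b * c"]) (auto simp: restrict_def)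
  ultimately show ?thesis unfolding proj_class_def by fastforce
qed

text \<open>\<open>the_elem\<close> is meaningful only on a singleton: the action rescales masses,
  and the orbit is non-empty since \<open>\<omega> = 0\<close> fixes \<open>\<tau>\<close>.\<close>

lemma (in triangulated_category) mass_map_orbit:
  assumes "orb \<in> Stab_mod_C C" "q > 0" "S \<subseteq> Ob C"
  shows "\<exists>\<tau>\<in>Stab C. mass_map C q S orb = proj_class S (\<lambda>s\<in>S. mass C q \<tau> s)"
proof -
  obtain \<tau> where \<tau>: "\<tau> \<in> Stab C" "orb = C_orbit_rel C `` {\<tau>}"
    using assms(1) unfolding Stab_mod_C_def by (rule quotientE)
  have "proj_class S (\<lambda>s\<in>S. mass C q \<sigma> s) = proj_class S (\<lambda>s\<in>S. mass C q \<tau> s)" if \<sigma>: "\<sigma> \<in> orb" for \<sigma>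
  proof -
    obtain \<omega> where \<omega>: "\<sigma> = C_action C \<omega> \<tau>" "\<sigma> \<in> Stab C"
      using \<sigma> unfolding \<tau>(2) C_orbit_rel_def by auto
    define c where "c = q powr (Im \<omega> / pi) * exp (Re \<omega>)"
    have "c \<noteq> 0" unfolding c_def using assms(2) by simp
    moreover have "(\<lambda>s\<in>S. mass C q \<sigma> s) = (\<lambda>s\<in>S. c * (\<lambda>s\<in>S. mass C q \<tau> s) s)"
      unfolding c_def using mass_C_action[OF \<tau>(1) _ assms(2)] \<omega> assms(3) by (intro restrict_ext) auto
    ultimately show ?thesis using proj_class_scale by metis
  qed
  moreover have "\<tau> \<in> orb"
  proof -
    \<comment> \<open>Extensionality of the charge makes its restriction to the carrier give it back
      unchanged.\<close>
    have "C_action C 0 \<tau> = \<tau>"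
      using \<tau>(1) unfolding C_action_def Stab_def by (auto simp: extensional_restrict)
    then show ?thesis using \<tau> unfolding C_orbit_rel_def by (auto intro!: exI[of _ 0])
  qed
  ultimately have "(\<lambda>\<tau>. proj_class S (\<lambda>s\<in>S. mass C q \<tau> s)) ` orb = {proj_class S (\<lambda>s\<in>S. mass C q \<tau> s)}"
    by blast
  then show ?thesis unfolding mass_map_def using \<tau>(1) by auto
qed

text \<open>It suffices to enclose \<open>A\<close> in a set that is both compact and closed. The
  image of \<open>D\<close> is compact as a continuous image, and closed because its preimage in the
  punctured space is.\<close>

lemma compactin_closure_bounded:
  fixes K :: "'a \<Rightarrow> real" and ps :: "'i \<Rightarrow> 'a"
  assumes S: "S \<noteq> {}" and ps: "\<And>i. i \<in> I \<Longrightarrow> ps i \<in> S" and K: "\<And>s. s \<in> S \<Longrightarrow> 0 \<le> K s"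
    and A: "\<And>l. l \<in> A \<Longrightarrow> \<exists>f. l = proj_class S (\<lambda>s\<in>S. f s) \<and> (\<exists>s\<in>S. f s \<noteq> 0) \<and>
      (\<forall>s\<in>S. 0 \<le> f s \<and> f s \<le> K s * (\<Sum>i\<in>I. f (ps i)))"
    and fin: "finite I"
  shows "compactin (projective_space S) (projective_space S closure_of A)"
proof -
  let ?X = "powertop_real S"
  define N where "N f = (\<Sum>i\<in>I. f (ps i))" for f :: "'a \<Rightarrow> real"
  have ev: "continuous_map ?X euclideanreal (\<lambda>f. f s)" if "s \<in> S" for s
    using that by (rule continuous_map_product_projection)
  have N: "continuous_map ?X euclideanreal N"
    unfolding N_def using fin ps ev by (intro continuous_map_sum) auto
  have N_scale: "N (\<lambda>s\<in>S. c * f s) = c * N f" for c f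
    unfolding N_def sum_distrib_left using ps by (intro sum.cong) auto
  \<comment> \<open>Normalising \<open>N f = 1\<close> turns the bounds into
    \<open>f s \<le> K s\<close>, so Tychonoff applies to a product of intervals.\<close>
  define D where "D = (\<Pi>\<^sub>E s\<in>S. {0..K s}) \<inter> {f \<in> topspace ?X. N f \<in> {1}}"
  have "compactin ?X D"
    unfolding D_def
    by (intro compact_Int_closedin closedin_continuous_map_preimage[OF N])
      (auto simp: compactin_PiE)
  moreover have "D \<subseteq> - {\<lambda>s\<in>S. 0}"
    using N_scale[of 0 "\<lambda>_. 0"] unfolding D_def by auto
  ultimately have "compactin (punctured S) D"
    unfolding punctured_def compactin_subtopology by blast
  moreover have qm: "quotient_map (punctured S) (projective_space S) (proj_class S)"
    unfolding projective_space_def by (rule quotient_map_quotient_topology)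
  ultimately have cpt: "compactin (projective_space S) (proj_class S ` D)"
    using image_compactin quotient_imp_continuous_map by blast
  \<comment> \<open>As \<open>N\<close> is linear, \<open>f \<in> E b\<close> says that
    \<open>b * f\<close> obeys the bounds; \<open>b = 1\<close> and \<open>b = -1\<close> account
    for the two directions of a line.\<close>
  define E where "E b = {f \<in> topspace ?X. \<forall>s\<in>S. 0 \<le> b * f s \<and> b * f s \<le> K s * (b * N f)}" for b :: real
  have E: "closedin ?X (E b)" for b
  proof -
    \<comment> \<open>With \<open>S\<close> empty the intersection would exceed the
      \<open>topspace\<close>.\<close>
    have "E b = (\<Inter>s\<in>S. {f \<in> topspace ?X. b * f s \<in> {0..}} \<inter> {f \<in> topspace ?X. K s * (b * N f) - b * f s \<in> {0..}})"
      unfolding E_def using S by auto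
    moreover have "closedin ?X {f \<in> topspace ?X. b * f s \<in> {0..}}" if "s \<in> S" for s
      by (rule closedin_continuous_map_preimage) (use ev[OF that] in \<open>auto intro!: continuous_intros\<close>)
    moreover have "closedin ?X {f \<in> topspace ?X. K s * (b * N f) - b * f s \<in> {0..}}" if "s \<in> S" for s
      by (rule closedin_continuous_map_preimage) (use ev[OF that] N in \<open>auto intro!: continuous_intros\<close>)
    ultimately show ?thesis using S by (auto intro!: closedin_INT)
  qed
  have mem: "proj_class S f \<in> proj_class S ` D"
    if f: "f \<in> E b" "f s \<noteq> 0" "s \<in> S" "b \<noteq> 0" for f b s
  proof -
    have "N f \<noteq> 0" using f unfolding E_def by fastforce
    \<comment> \<open>One non-zero value forces the normaliser to be positive, as \<open>K s\<close>
      is non-negative.\<close>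
    have "0 < b * N f"
    proof -
      have "0 < b * f s" using f unfolding E_def by (force simp: less_le)
      also have "\<dots> \<le> K s * (b * N f)" using f unfolding E_def by blast
      finally show ?thesis using K[OF f(3)] by (simp add: zero_less_mult_iff)
    qed
    have "(\<lambda>s\<in>S. 1 / N f * f s) \<in> D"
    proof -
      have "0 \<le> 1 / N f * f r \<and> 1 / N f * f r \<le> K r" if "r \<in> S" for r
      proof -
        have "0 \<le> b * f r" "b * f r \<le> K r * (b * N f)" using f that unfolding E_def by auto
        \<comment> \<open>Dividing by \<open>b * N f\<close> cancels \<open>b\<close>, so both signs
          are handled at once.\<close>
        then have "0 \<le> (b * f r) / (b * N f)" "(b * f r) / (b * N f) \<le> K r"
          using \<open>0 < b * N f\<close> by (simp_all only: divide_nonneg_pos pos_divide_le_eq)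
        then show ?thesis using f(4) by simp
      qed
      then show ?thesis
        unfolding D_def using N_scale[of "1 / N f" f] \<open>N f \<noteq> 0\<close> by (auto simp: restrict_def PiE_def extensional_def)
    qed
    moreover have "proj_class S (\<lambda>s\<in>S. 1 / N f * f s) = proj_class S f"
      using \<open>N f \<noteq> 0\<close> by (intro proj_class_scale) simp
    ultimately show ?thesis by (metis image_eqI)
  qed
  have "{f \<in> topspace (punctured S). proj_class S f \<in> proj_class S ` D} = topspace (punctured S) \<inter> (E 1 \<union> E (-1))"
  proof (intro Set.set_eqI iffI)
    fix f assume f: "f \<in> {f \<in> topspace (punctured S). proj_class S f \<in> proj_class S ` D}"
    then obtain d where d: "d \<in> D" "proj_class S f = proj_class S d" by blast
    have "f \<in> extensional S" using f unfolding punctured_def by (simp add: PiE_def)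
    then have "f \<in> proj_class S f"
      unfolding proj_class_def
      by (intro CollectI exI[of _ 1] conjI) (simp_all add: extensional_restrict)
    then have "f \<in> proj_class S d" unfolding d(2) .
    then obtain c where c: "c \<noteq> 0" "f = (\<lambda>s\<in>S. c * d s)"
      unfolding proj_class_def mem_Collect_eq by (elim exE conjE) (rule that)
    \<comment> \<open>The normaliser is \<open>1\<close> on \<open>D\<close>, so \<open>N\<close>
      recovers the scalar, whose sign decides between \<open>E 1\<close> and
      \<open>E (-1)\<close>.\<close>
    have "N f = c" using N_scale d(1) unfolding c(2) D_def by simp
    moreover have "d s \<ge> 0 \<and> d s \<le> K s" if "s \<in> S" for s using d(1) that unfolding D_def by auto
    ultimately have "f \<in> E 1 \<union> E (-1)"
      using f c unfolding E_def punctured_def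
      by (cases "c > 0") (auto simp: mult.commute[of _ c] mult_nonpos_nonneg mult_left_mono)
    then show "f \<in> topspace (punctured S) \<inter> (E 1 \<union> E (-1))" using f by blast
  next
    fix f assume f: "f \<in> topspace (punctured S) \<inter> (E 1 \<union> E (-1))"
    then have "f \<in> extensional S" "f \<noteq> (\<lambda>s\<in>S. 0)" unfolding punctured_def by (auto simp: PiE_def)
    then obtain s where s: "s \<in> S" "f s \<noteq> 0"
      using extensionalityI[of f S "\<lambda>s\<in>S. 0"] by auto
    then show "f \<in> {f \<in> topspace (punctured S). proj_class S f \<in> proj_class S ` D}"
      using f mem[of f 1 s] mem[of f "-1" s] by auto
  qed
  moreover have "closedin (punctured S) (topspace (punctured S) \<inter> (E 1 \<union> E (-1)))"
  proof -
    have "topspace (punctured S) \<inter> (E 1 \<union> E (-1)) = (E 1 \<union> E (-1)) \<inter> - {\<lambda>s\<in>S. 0}"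
      using closedin_subset[OF E[of 1]] closedin_subset[OF E[of "-1"]]
      unfolding punctured_def topspace_subtopology by blast
    then show ?thesis
      unfolding punctured_def closedin_subtopology using closedin_Un[OF E[of 1] E[of "-1"]] by blast
  qed
  ultimately have clo: "closedin (projective_space S) (proj_class S ` D)"
    using qm compactin_subset_topspace[OF cpt] unfolding quotient_map_closedin by auto
  have "A \<subseteq> proj_class S ` D"
  proof
    fix l assume "l \<in> A"
    then obtain f s where f: "l = proj_class S (\<lambda>s\<in>S. f s)" "s \<in> S" "f s \<noteq> 0"
      "\<forall>s\<in>S. 0 \<le> f s \<and> f s \<le> K s * N f" using A unfolding N_def by blast
    have "N (\<lambda>s\<in>S. f s) = N f" using N_scale[of 1 f] by simp
    then have "(\<lambda>s\<in>S. f s) \<in> E 1" unfolding E_def using f by auto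
    then show "l \<in> proj_class S ` D" using mem[of "\<lambda>s\<in>S. f s" 1 s] f by simp
  qed
  then have "projective_space S closure_of A \<subseteq> proj_class S ` D" using closure_of_minimal clo by blast
  then show ?thesis using closed_compactin[OF cpt] closedin_closure_of by blast
qed

theorem proposition4p1:
  fixes C :: "('o, 'm) tricat" and q :: real and S :: "'o set"
    and n :: nat and ps :: "nat \<Rightarrow> 'o" and p :: 'o
  assumes "triangulated_category C"
    and "q > 0"
    and "S \<subseteq> Ob C" and "S \<noteq> {}" and "\<forall>s\<in>S. \<not> zero_object C s"
    and "\<forall>i\<in>{1..n}. ps i \<in> S"
    and "is_direct_sum C {1..n} ps p"
    and "classical_generator C p"
  shows "compactin (projective_space S)
           (projective_space S closure_of (mass_map C q S ` Stab_mod_C C))"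
proof -
  interpret triangulated_category C by fact
  \<comment> \<open>\<open>K\<close> must be uniform in \<open>\<tau>\<close> but may depend on
    \<open>s\<close>, since each coordinate of the product has its own interval.\<close>
  have "\<forall>s. \<exists>K. s \<in> S \<longrightarrow> K \<ge> 0 \<and> (\<forall>\<tau>\<in>Stab C. mass C q \<tau> s \<le> K * (\<Sum>i\<in>{1..n}. mass C q \<tau> (ps i)))"
    using generator_sum_mass_bound[OF assms(2,8) _ assms(7)] assms(3) by blast
  then obtain K where K: "\<And>s. s \<in> S \<Longrightarrow> K s \<ge> 0"
      "\<And>s \<tau>. s \<in> S \<Longrightarrow> \<tau> \<in> Stab C \<Longrightarrow> mass C q \<tau> s \<le> K s * (\<Sum>i\<in>{1..n}. mass C q \<tau> (ps i))"
    by metis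
  show ?thesis
  proof (rule compactin_closure_bounded[where K = K and I = "{1..n}" and ps = ps])
    fix l assume "l \<in> mass_map C q S ` Stab_mod_C C"
    then obtain \<tau> where \<tau>: "\<tau> \<in> Stab C" "l = proj_class S (\<lambda>s\<in>S. mass C q \<tau> s)"
      using mass_map_orbit assms(2,3) by blast
    \<comment> \<open>Objects of \<open>S\<close> are non-zero, so the mass function avoids the
      origin and does define a point.\<close>
    have pos: "0 < mass C q \<tau> s" if "s \<in> S" for s
      using mass_pos[OF \<tau>(1) assms(2)] assms(3,5) that by blast
    then have "\<exists>s\<in>S. mass C q \<tau> s \<noteq> 0" using assms(4) by (metis equals0I less_irrefl)
    then show "\<exists>f. l = proj_class S (\<lambda>s\<in>S. f s) \<and> (\<exists>s\<in>S. f s \<noteq> 0) \<and>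
        (\<forall>s\<in>S. 0 \<le> f s \<and> f s \<le> K s * (\<Sum>i\<in>{1..n}. f (ps i)))"
      using \<tau> K(2) pos by (intro exI[of _ "mass C q \<tau>"]) (auto simp: less_imp_le)
  qed (use assms K(1) in auto)
qed

end
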